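(* The seeded tiling problem for the lamplighter group $L$ (with generating set $S=\{a^{\pm1},b^{\pm1}\}$) is unsolvable: there is no algorithm which, given a finite set $A$, a subset $\Pi\subseteq A\times S\times A$ and an element $a_0\in A$, decides whether there exists a map $\phi\colon L\to A$ with $\phi(1)=a_0$ and $(\phi(g),s,\phi(gs))\in\Pi$ for all $g\in L$ and all $s\in S$.
   Context: The lamplighter group is $L=\mathbb Z/2\wr\mathbb Z$. Concretely, its elements are pairs $(s,n)$ with $n\in\mathbb Z$ and $s\colon \mathbb Z+\tfrac12\to\mathbb Z/2$ finitely supported. The product is $(r,m)(s,n)=(t,m+n)$ with $t_i=r_i+s_{i-m}$. The generators are $a=(0,1)$ and $b=(\delta_{1/2},1)$, where $\delta_{1/2}$ is the function equal to $1$ at $1/2$ and $0$ elsewhere. Equivalently, $L=\langle a,b\mid (a^nb^{-n})^2\ (n\ge1)\rangle$. *)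

theory Defs
  imports "HOL-Algebra.Group" "HOL-Library.Z2" "HOL-Library.Nat_Bijection"
begin

text \<open>The integer \<open>k\<close> stands for the half-integer lamp position \<open>k + 1/2\<close>, so that
  the lamp at \<open>1/2\<close> has index \<open>0\<close>; type \<^typ>\<open>bit\<close> is the field with two elements.\<close>

type_synonym lamp = "(int \<Rightarrow> bit) \<times> int"

definition lamplighter :: "lamp monoid" where
  "lamplighter =
    \<lparr> carrier = {(s, n). finite {i. s i \<noteq> 0}},
      mult = (\<lambda>(r, m) (s, n). (\<lambda>i. r i + s (i - m), m + n)),
      one = (\<lambda>i. 0, 0) \<rparr>"

definition lamp_a :: lamp where
  "lamp_a = (\<lambda>i. 0, 1)"

definition lamp_b :: lamp where
  "lamp_b = (\<lambda>i. if i = 0 then 1 else 0, 1)"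

definition lamp_gens :: "lamp set" where
  "lamp_gens = {lamp_a, inv\<^bsub>lamplighter\<^esub> lamp_a, lamp_b, inv\<^bsub>lamplighter\<^esub> lamp_b}"

lemma group_lamplighter: "group lamplighter"
proof (rule groupI)
  fix x y
  assume "x \<in> carrier lamplighter" "y \<in> carrier lamplighter"
  then obtain r m s n where xy: "x = (r, m)" "y = (s, n)"
    and fin: "finite {i. r i \<noteq> 0}" "finite {i. s i \<noteq> 0}"
    by (auto simp: lamplighter_def)
  have "{i. r i + s (i - m) \<noteq> 0} \<subseteq> {i. r i \<noteq> 0} \<union> (\<lambda>i. i + m) ` {i. s i \<noteq> 0}"
  proof
    fix i
    assume "i \<in> {i. r i + s (i - m) \<noteq> 0}"
    then have "r i \<noteq> 0 \<or> s (i - m) \<noteq> 0" by (cases "r i = 0") simp_all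
    then show "i \<in> {i. r i \<noteq> 0} \<union> (\<lambda>i. i + m) ` {i. s i \<noteq> 0}"
      using image_eqI[of i "\<lambda>i. i + m" "i - m" "{i. s i \<noteq> 0}"] by auto
  qed
  then have "finite {i. r i + s (i - m) \<noteq> 0}"
    by (rule finite_subset) (use fin in auto)
  then show "x \<otimes>\<^bsub>lamplighter\<^esub> y \<in> carrier lamplighter"
    by (simp add: lamplighter_def xy)
next
  fix x
  assume "x \<in> carrier lamplighter"
  then obtain r m where x: "x = (r, m)" and fin: "finite {i. r i \<noteq> 0}"
    by (auto simp: lamplighter_def)
  let ?y = "(\<lambda>i. r (i + m), - m)"
  have "{i. r (i + m) \<noteq> 0} \<subseteq> (\<lambda>i. i - m) ` {i. r i \<noteq> 0}"
  proof
    fix i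
    assume "i \<in> {i. r (i + m) \<noteq> 0}"
    then show "i \<in> (\<lambda>i. i - m) ` {i. r i \<noteq> 0}"
      using image_eqI[of i "\<lambda>i. i - m" "i + m"] by simp
  qed
  then have "finite {i. r (i + m) \<noteq> 0}"
    by (rule finite_subset) (use fin in auto)
  then have "?y \<in> carrier lamplighter" and "?y \<otimes>\<^bsub>lamplighter\<^esub> x = \<one>\<^bsub>lamplighter\<^esub>"
    by (simp_all add: lamplighter_def x fun_eq_iff split: bit.split)
  then show "\<exists>y\<in>carrier lamplighter. y \<otimes>\<^bsub>lamplighter\<^esub> x = \<one>\<^bsub>lamplighter\<^esub>"
    by blast
next
  fix x y z
  assume "x \<in> carrier lamplighter" "y \<in> carrier lamplighter" "z \<in> carrier lamplighter"
  obtain r m s n t k where "x = (r, m)" "y = (s, n)" "z = (t, k)"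
    by (metis surj_pair)
  then show "x \<otimes>\<^bsub>lamplighter\<^esub> y \<otimes>\<^bsub>lamplighter\<^esub> z =
      x \<otimes>\<^bsub>lamplighter\<^esub> (y \<otimes>\<^bsub>lamplighter\<^esub> z)"
    by (simp add: lamplighter_def add.assoc diff_diff_eq del: add_bit_eq_xor)
qed (auto simp: lamplighter_def)

lemma lamp_gens_subset: "lamp_gens \<subseteq> carrier lamplighter"
proof -
  interpret group lamplighter by (rule group_lamplighter)
  have "lamp_a \<in> carrier lamplighter" "lamp_b \<in> carrier lamplighter"
    by (auto simp: lamplighter_def lamp_a_def lamp_b_def)
  then show ?thesis by (simp add: lamp_gens_def)
qed

definition seeded_tileable ::
  "('g, 'm) monoid_scheme \<Rightarrow> 'g set \<Rightarrow> 'a set \<Rightarrow> ('a \<times> 'g \<times> 'a) set \<Rightarrow> 'a \<Rightarrow> bool" where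
  "seeded_tileable G S A P a0 \<longleftrightarrow>
    (\<exists>\<phi> \<in> carrier G \<rightarrow> A. \<phi> \<one>\<^bsub>G\<^esub> = a0 \<and>
      (\<forall>g \<in> carrier G. \<forall>s \<in> S. (\<phi> g, s, \<phi> (g \<otimes>\<^bsub>G\<^esub> s)) \<in> P))"

text \<open>Kleene's partial recursive functions: \<open>recf_eval f xs y\<close> says that the computation of
  \<open>f\<close> on the argument list \<open>xs\<close> terminates with value \<open>y\<close>. Arities are not recorded in the
  syntax: \<open>Zero\<close> is the zero function of every arity, \<open>Proj i\<close> the \<open>i\<close>-th projection (from
  \<open>0\<close>) of every arity above \<open>i\<close>, and an arity mismatch gives no value.\<close>

datatype recf =
    Zero
  | Succ
  | Proj nat
  | Comp recf "recf list"
  | PrimRec recf recf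
  | Mu recf

inductive recf_eval :: "recf \<Rightarrow> nat list \<Rightarrow> nat \<Rightarrow> bool" where
  Zero: "recf_eval Zero xs 0"
| Succ: "recf_eval Succ [x] (Suc x)"
| Proj: "i < length xs \<Longrightarrow> recf_eval (Proj i) xs (xs ! i)"
| Comp: "list_all2 (\<lambda>g y. recf_eval g xs y) gs ys \<Longrightarrow> recf_eval f ys z \<Longrightarrow>
    recf_eval (Comp f gs) xs z"
| PrimRec_0: "recf_eval f xs y \<Longrightarrow> recf_eval (PrimRec f g) (0 # xs) y"
| PrimRec_Suc: "recf_eval (PrimRec f g) (n # xs) y \<Longrightarrow> recf_eval g (n # y # xs) z \<Longrightarrow>
    recf_eval (PrimRec f g) (Suc n # xs) z"
| Mu: "recf_eval f (n # xs) 0 \<Longrightarrow> (\<forall>m<n. \<exists>k. recf_eval f (m # xs) (Suc k)) \<Longrightarrow>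
    recf_eval (Mu f) xs n"

inductive_cases recf_eval_ZeroE: "recf_eval Zero xs z"
inductive_cases recf_eval_SuccE: "recf_eval Succ xs z"
inductive_cases recf_eval_ProjE: "recf_eval (Proj i) xs z"
inductive_cases recf_eval_CompE: "recf_eval (Comp f gs) xs z"
inductive_cases recf_eval_PrimRec_0E: "recf_eval (PrimRec f g) (0 # xs) z"
inductive_cases recf_eval_PrimRec_SucE: "recf_eval (PrimRec f g) (Suc n # xs) z"
inductive_cases recf_eval_MuE: "recf_eval (Mu f) xs z"

lemma recf_eval_functional: "recf_eval f xs y \<Longrightarrow> recf_eval f xs z \<Longrightarrow> y = z"
proof (induction f xs y arbitrary: z rule: recf_eval.induct)
  case (Zero xs)
  then show ?case by (rule recf_eval_ZeroE) simp
next
  case (Succ x)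
  then show ?case by (rule recf_eval_SuccE) simp
next
  case (Proj i xs)
  show ?case using Proj.prems by (rule recf_eval_ProjE) simp
next
  case (Comp xs gs ys f y)
  from Comp.prems obtain ys' where
    ys': "list_all2 (\<lambda>g y. recf_eval g xs y) gs ys'" and "recf_eval f ys' z"
    by (rule recf_eval_CompE)
  have "ys = ys'"
  proof (rule nth_equalityI)
    show "length ys = length ys'"
      using list_all2_lengthD[OF Comp.IH(1)] list_all2_lengthD[OF ys'] by (rule trans[OF sym])
    fix i
    assume "i < length ys"
    then show "ys ! i = ys' ! i"
      using list_all2_nthD2[OF Comp.IH(1)] list_all2_nthD[OF ys']
        list_all2_lengthD[OF Comp.IH(1)] by metis
  qed
  with \<open>recf_eval f ys' z\<close> have "recf_eval f ys z" by (rule subst[OF sym, rotated])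
  then show ?case by (rule Comp.IH(2))
next
  case (PrimRec_0 f xs y g)
  from PrimRec_0.prems have "recf_eval f xs z"
    by (rule recf_eval_PrimRec_0E)
  then show ?case by (rule PrimRec_0.IH)
next
  case (PrimRec_Suc f g n xs y w)
  from PrimRec_Suc.prems obtain y' where
    "recf_eval (PrimRec f g) (n # xs) y'" "recf_eval g (n # y' # xs) z"
    by (rule recf_eval_PrimRec_SucE)
  then show ?case using PrimRec_Suc.IH by blast
next
  case (Mu f n xs)
  from Mu.prems have z: "recf_eval f (z # xs) 0" "\<forall>m<z. \<exists>k. recf_eval f (m # xs) (Suc k)"
    by (auto elim: recf_eval_MuE)
  show ?case
  proof (cases n z rule: linorder_cases)
    case less
    then obtain k where "recf_eval f (n # xs) (Suc k)" using z(2) by (elim allE impE exE)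
    then have "0 = Suc k" by (rule Mu.IH(1))
    then show ?thesis by simp
  next
    case greater
    from Mu.IH(2)[rule_format, OF this] obtain k
      where "\<forall>w. recf_eval f (z # xs) w \<longrightarrow> Suc k = w" by (elim exE conjE)
    then have "Suc k = 0" using z(1) by (elim allE impE)
    then show ?thesis by simp
  qed
qed

text \<open>Colours are natural numbers, so the colour set of an instance is an arbitrary finite set of
  natural numbers. Finite sets are coded by their binary expansions.\<close>

definition lamp_gen_code :: "lamp \<Rightarrow> nat" where
  "lamp_gen_code s =
    (if s = lamp_a then 0 else if s = inv\<^bsub>lamplighter\<^esub> lamp_a then 1
     else if s = lamp_b then 2 else 3)"

definition edge_code :: "nat \<times> lamp \<times> nat \<Rightarrow> nat" where
  "edge_code = (\<lambda>(c, s, d). prod_encode (c, prod_encode (lamp_gen_code s, d)))"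

definition instance_code :: "nat set \<Rightarrow> (nat \<times> lamp \<times> nat) set \<Rightarrow> nat \<Rightarrow> nat" where
  "instance_code A P a0 =
    prod_encode (set_encode A, prod_encode (set_encode (edge_code ` P), a0))"

lemma inj_on_lamp_gen_code: "inj_on lamp_gen_code lamp_gens"
  by (auto simp: inj_on_def lamp_gens_def lamp_gen_code_def)

lemma instance_code_inject:
  assumes "finite A" "P \<subseteq> A \<times> lamp_gens \<times> A" "finite A'" "P' \<subseteq> A' \<times> lamp_gens \<times> A'"
    and "instance_code A P a0 = instance_code A' P' a0'"
  shows "A = A' \<and> P = P' \<and> a0 = a0'"
proof -
  have inj: "inj_on edge_code (UNIV \<times> lamp_gens \<times> UNIV)"
    using inj_on_lamp_gen_code by (auto simp: inj_on_def edge_code_def)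
  have "finite lamp_gens" by (simp add: lamp_gens_def)
  then have "finite P" "finite P'"
    using finite_subset[OF assms(2)] finite_subset[OF assms(4)] assms(1,3) by simp_all
  then have "A = A'" "edge_code ` P = edge_code ` P'" "a0 = a0'"
    using assms(1,3,5) by (auto simp: instance_code_def set_encode_eq)
  moreover have "P \<subseteq> UNIV \<times> lamp_gens \<times> UNIV" "P' \<subseteq> UNIV \<times> lamp_gens \<times> UNIV"
    using assms(2,4) by auto
  ultimately show ?thesis
    using inj_on_image_eq_iff[OF inj] by blast
qed

end

theory Submission
  imports Defs
begin

text \<open>
  In the coordinates \<open>(x, y, n)\<close>, where the bits of \<open>y\<close> are the lamps to the right of the
  origin and those of \<open>x\<close> the lamps to the left, the part of the group above level \<open>0\<close>, with \<open>x\<close>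
  fixed, contains the binary tree of the dyadic intervals of \<open>y\<close>: the node
  \<open>(x, y * 2 ^ j, j)\<close> stands for the interval \<open>[y * 2 ^ j, (y + 1) * 2 ^ j)\<close>, and its neighbours
  below along \<open>a\<close> and \<open>b\<close> are the two halves. Colouring a node with the outer and middle edge
  colours of its interval therefore forces the Wang matching condition between \<open>(x, y, 0)\<close> and
  \<open>(x, y + 1, 0)\<close>; below level \<open>0\<close> the same happens for \<open>x\<close>. So the elements of level \<open>0\<close> carry a
  Wang tiling of a quadrant, in which register programs are simulated.

  Suppose that \<open>f\<close> decides the problem. A chain of \<open>n\<close> additional colours above the seed makes
  \<open>2 ^ (n + 2)\<close> the input of the simulated program. Let the program compute, from \<open>2 ^ (p + 2)\<close>, the
  answer of \<open>f\<close> on the instance consisting of the edges coded by \<open>p\<close> together with a chain of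
  length \<open>p\<close>, and halt if the answer is yes. For \<open>p\<close> the code of the tile set of this very program,
  the instance has a tiling if and only if the program does not halt, which contradicts the answer.
\<close>

subsection \<open>Computable functions\<close>

definition computable :: "nat \<Rightarrow> (nat list \<Rightarrow> nat) \<Rightarrow> bool" where
  "computable n F \<longleftrightarrow> (\<exists>f. \<forall>xs. length xs = n \<longrightarrow> recf_eval f xs (F xs))"

lemma computable_const: "computable n (\<lambda>_. c)"
proof (induction c)
  case 0
  then show ?case unfolding computable_def by (metis recf_eval.Zero)
next
  case (Suc c)
  then obtain f where f: "\<forall>xs. length xs = n \<longrightarrow> recf_eval f xs c"
    unfolding computable_def by blast
  have "recf_eval (Comp Succ [f]) xs (Suc c)" if "length xs = n" for xs
    by (rule recf_eval.Comp[where ys = "[c]"]) (use f that in \<open>auto intro: recf_eval.Succ\<close>)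
  then show ?case unfolding computable_def by blast
qed

lemma computable_nth: "i < n \<Longrightarrow> computable n (\<lambda>xs. xs ! i)"
  unfolding computable_def by (metis recf_eval.Proj)

lemma computable_Suc:
  assumes "computable n F"
  shows "computable n (\<lambda>xs. Suc (F xs))"
proof -
  from assms obtain f where f: "\<forall>xs. length xs = n \<longrightarrow> recf_eval f xs (F xs)"
    unfolding computable_def by blast
  have "recf_eval (Comp Succ [f]) xs (Suc (F xs))" if "length xs = n" for xs
    by (rule recf_eval.Comp[where ys = "[F xs]"]) (use f that in \<open>auto intro: recf_eval.Succ\<close>)
  then show ?thesis unfolding computable_def by blast
qed

text \<open>The closure properties below all go through this form of primitive recursion: in the
  argument list of \<open>S\<close>, entry \<open>0\<close> is the counter and entry
  \<open>1\<close> the value so far. In the term, projections copy \<open>xs\<close> behind the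
  computed counter.\<close>

lemma computable_rec_nat:
  assumes "computable n N" "computable n A" "computable (Suc (Suc n)) S"
  shows "computable n (\<lambda>xs. rec_nat (A xs) (\<lambda>i y. S (i # y # xs)) (N xs))"
proof -
  from assms obtain fN fA fS where f:
    "\<And>xs. length xs = n \<Longrightarrow> recf_eval fN xs (N xs)"
    "\<And>xs. length xs = n \<Longrightarrow> recf_eval fA xs (A xs)"
    "\<And>xs. length xs = Suc (Suc n) \<Longrightarrow> recf_eval fS xs (S xs)"
    unfolding computable_def by metis
  have prec: "recf_eval (PrimRec fA fS) (k # xs) (rec_nat (A xs) (\<lambda>i y. S (i # y # xs)) k)"
    if "length xs = n" for xs k
  proof (induction k)
    case 0
    then show ?case using f(2)[OF that] by (auto intro: recf_eval.PrimRec_0)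
  next
    case (Suc k)
    then show ?case
      by (auto intro!: recf_eval.PrimRec_Suc f(3) simp: that)
  qed
  have "recf_eval (Comp (PrimRec fA fS) (fN # map Proj [0..<n])) xs
      (rec_nat (A xs) (\<lambda>i y. S (i # y # xs)) (N xs))" if "length xs = n" for xs
  proof (rule recf_eval.Comp[where ys = "N xs # xs"])
    show "list_all2 (\<lambda>g y. recf_eval g xs y) (fN # map Proj [0..<n]) (N xs # xs)"
      using f(1) that
      by (auto simp: list_all2_conv_all_nth nth_Cons intro: recf_eval.Proj split: nat.split)
  qed (rule prec[OF that])
  then show ?thesis unfolding computable_def by blast
qed

lemma computable_add:
  assumes "computable n F" "computable n G"
  shows "computable n (\<lambda>xs. F xs + G xs)"
proof -
  have eq: "rec_nat (G xs) (\<lambda>i y. Suc ((i # y # xs) ! 1)) k = k + G xs" for xs k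
    by (induction k) auto
  have "computable n (\<lambda>xs. rec_nat (G xs) (\<lambda>i y. Suc ((i # y # xs) ! 1)) (F xs))"
    by (rule computable_rec_nat[OF assms, where S = "\<lambda>zs. Suc (zs ! 1)"])
      (intro computable_Suc computable_nth; simp)
  then show ?thesis by (simp only: eq)
qed

lemma computable_pred:
  assumes "computable n F"
  shows "computable n (\<lambda>xs. F xs - 1)"
proof -
  have eq: "rec_nat 0 (\<lambda>i y. (i # y # xs) ! 0) k = k - 1" for xs :: "nat list" and k
    by (cases k) auto
  have "computable n (\<lambda>xs. rec_nat 0 (\<lambda>i y. (i # y # xs) ! 0) (F xs))"
    by (rule computable_rec_nat[OF assms computable_const, where S = "\<lambda>zs. zs ! 0"])
      (intro computable_nth; simp)
  then show ?thesis by (simp only: eq)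
qed

lemma computable_diff:
  assumes "computable n F" "computable n G"
  shows "computable n (\<lambda>xs. F xs - G xs)"
proof -
  have eq: "rec_nat (F xs) (\<lambda>i y. (i # y # xs) ! 1 - 1) k = F xs - k" for xs k
    by (induction k) auto
  have "computable n (\<lambda>xs. rec_nat (F xs) (\<lambda>i y. (i # y # xs) ! 1 - 1) (G xs))"
    by (rule computable_rec_nat[OF assms(2,1), where S = "\<lambda>zs. zs ! 1 - 1"])
      (intro computable_pred computable_nth; simp)
  then show ?thesis by (simp only: eq)
qed

lemma computable_power2:
  assumes "computable n F"
  shows "computable n (\<lambda>xs. 2 ^ F xs)"
proof -
  have eq: "rec_nat 1 (\<lambda>i y. (i # y # xs) ! 1 + (i # y # xs) ! 1) k = 2 ^ k"
    for xs :: "nat list" and k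
    by (induction k) auto
  have "computable n (\<lambda>xs. rec_nat 1 (\<lambda>i y. (i # y # xs) ! 1 + (i # y # xs) ! 1) (F xs))"
    by (rule computable_rec_nat[OF assms computable_const, where S = "\<lambda>zs. zs ! 1 + zs ! 1"])
      (intro computable_add computable_nth; simp)
  then show ?thesis by (simp only: eq)
qed

lemma computable_triangle:
  assumes "computable n F"
  shows "computable n (\<lambda>xs. triangle (F xs))"
proof -
  have eq: "rec_nat 0 (\<lambda>i y. Suc ((i # y # xs) ! 1 + (i # y # xs) ! 0)) k = triangle k"
    for xs :: "nat list" and k
    by (induction k) (auto simp: triangle_Suc)
  have "computable n (\<lambda>xs. rec_nat 0 (\<lambda>i y. Suc ((i # y # xs) ! 1 + (i # y # xs) ! 0)) (F xs))"
    by (rule computable_rec_nat[OF assms computable_const,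
        where S = "\<lambda>zs. Suc (zs ! 1 + zs ! 0)"])
      (intro computable_Suc computable_add computable_nth; simp)
  then show ?thesis by (simp only: eq)
qed

lemma computable_prod_encode:
  assumes "computable n F" "computable n G"
  shows "computable n (\<lambda>xs. prod_encode (F xs, G xs))"
  using computable_add[OF computable_triangle[OF computable_add[OF assms]] assms(1)]
  by (simp add: prod_encode_def)

lemma computable_sum:
  assumes "computable n N" "computable (Suc (Suc n)) S" and S: "\<And>i y xs. S (i # y # xs) = T i"
  shows "computable n (\<lambda>xs. \<Sum>i<N xs. T i)"
proof -
  have eq: "rec_nat 0 (\<lambda>i y. S (i # y # xs) + (i # y # xs) ! 1) k = (\<Sum>i<k. T i)"
    for xs :: "nat list" and k
    by (induction k) (auto simp: S)
  have "computable n (\<lambda>xs. rec_nat 0 (\<lambda>i y. S (i # y # xs) + (i # y # xs) ! 1) (N xs))"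
    by (rule computable_rec_nat[OF assms(1) computable_const,
        where S = "\<lambda>zs. S zs + zs ! 1"])
      (intro computable_add assms(2) computable_nth; simp)
  then show ?thesis by (simp only: eq)
qed

lemmas computable_intros = computable_const computable_nth computable_Suc computable_add
  computable_pred computable_diff computable_power2 computable_triangle computable_prod_encode

subsection \<open>Compiling recursive functions into register programs\<close>

text \<open>Each operation overwrites one register with zero or with a value within one of some
  source register. In unary notation the new content of a cell then depends only on the cell and its
  two horizontal neighbours, which a Wang tile can check.\<close>

datatype mode = Clr | Cpy | Inc | Dec

datatype com = Skip | Asg nat nat mode | Seq com com | While nat com

fun upd :: "mode \<Rightarrow> nat \<Rightarrow> nat" where
  "upd Clr v = 0"
| "upd Cpy v = v"
| "upd Inc v = Suc v"
| "upd Dec v = v - 1"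

text \<open>Register \<open>0\<close> is the default for commands that do not start with a loop;
  their successors are the same for both outcomes.\<close>

fun test :: "com \<Rightarrow> nat" where
  "test (While r c) = r"
| "test (Seq c1 c2) = test c1"
| "test _ = 0"

fun next_op :: "com \<Rightarrow> bool \<Rightarrow> nat \<times> nat \<times> mode" where
  "next_op (Asg d s m) b = (d, s, m)"
| "next_op (Seq c1 c2) b = next_op c1 b"
| "next_op _ b = (0, 0, Cpy)"

fun next_com :: "com \<Rightarrow> bool \<Rightarrow> com" where
  "next_com (Seq c1 c2) b = (if c1 = Skip then c2 else Seq (next_com c1 b) c2)"
| "next_com (While r c) b = (if b then Seq c (While r c) else Skip)"
| "next_com _ b = Skip"

definition apply_op :: "nat \<times> nat \<times> mode \<Rightarrow> (nat \<Rightarrow> nat) \<Rightarrow> nat \<Rightarrow> nat" where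
  "apply_op = (\<lambda>(d, s, m) \<sigma>. \<sigma>(d := upd m (\<sigma> s)))"

definition step :: "com \<times> (nat \<Rightarrow> nat) \<Rightarrow> com \<times> (nat \<Rightarrow> nat)" where
  "step = (\<lambda>(c, \<sigma>). let b = \<sigma> (test c) > 0 in (next_com c b, apply_op (next_op c b) \<sigma>))"

definition reach :: "com \<times> (nat \<Rightarrow> nat) \<Rightarrow> com \<times> (nat \<Rightarrow> nat) \<Rightarrow> bool" where
  "reach X Y \<longleftrightarrow> (\<exists>k. (step ^^ k) X = Y)"

section \<open>Reachability for composite commands\<close>

lemma apply_op_nop [simp]: "apply_op (0, 0, Cpy) \<sigma> = \<sigma>"
  by (simp add: apply_op_def)

lemma reach_refl: "reach X X"
  unfolding reach_def by (metis funpow_0)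

lemma reach_trans: "reach X Y \<Longrightarrow> reach Y Z \<Longrightarrow> reach X Z"
  unfolding reach_def by (metis comp_apply funpow_add)

lemma reach_step: "reach (step X) Y \<Longrightarrow> reach X Y"
  unfolding reach_def by (metis comp_apply funpow_Suc_right)

lemma step_Skip [simp]: "step (Skip, \<sigma>) = (Skip, \<sigma>)"
  by (simp add: step_def)

lemma funpow_step_Skip [simp]: "(step ^^ k) (Skip, \<sigma>) = (Skip, \<sigma>)"
  by (induction k) auto

lemma reach_Seq_left:
  assumes "reach (c1, \<sigma>) (Skip, \<sigma>')"
  shows "reach (Seq c1 c2, \<sigma>) (Seq Skip c2, \<sigma>')"
proof -
  have "reach (Seq c1 c2, \<sigma>) (Seq Skip c2, \<sigma>')" if "(step ^^ k) (c1, \<sigma>) = (Skip, \<sigma>')" for k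
    using that
  proof (induction k arbitrary: c1 \<sigma>)
    case 0
    then show ?case by (simp add: reach_refl)
  next
    case (Suc k)
    show ?case
    proof (cases "c1 = Skip")
      \<comment> \<open>\<open>Skip\<close> is a fixed point of \<open>step\<close>, so the number
        of steps may exceed the running time of \<open>c1\<close>; \<open>Seq Skip c2\<close> is not
        one, and the claim stops there.\<close>
      case True
      then have "(c1, \<sigma>) = (Skip, \<sigma>')"
        using Suc.prems funpow_step_Skip by metis
      then show ?thesis by (simp add: reach_refl)
    next
      case False
      obtain c' \<tau> where st: "step (c1, \<sigma>) = (c', \<tau>)" by fastforce
      then have "(step ^^ k) (c', \<tau>) = (Skip, \<sigma>')"
        using Suc.prems by (simp add: funpow_Suc_right del: funpow.simps)
      then have "reach (Seq c' c2, \<tau>) (Seq Skip c2, \<sigma>')" by (rule Suc.IH)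
      moreover have "step (Seq c1 c2, \<sigma>) = (Seq c' c2, \<tau>)"
        using st False by (auto simp: step_def Let_def)
      ultimately show ?thesis by (metis reach_step)
    qed
  qed
  then show ?thesis using assms unfolding reach_def by blast
qed

lemma reach_Seq:
  assumes "reach (c1, \<sigma>) (Skip, \<sigma>')" "reach (c2, \<sigma>') Y"
  shows "reach (Seq c1 c2, \<sigma>) Y"
proof -
  have "step (Seq Skip c2, \<sigma>') = (c2, \<sigma>')" by (simp add: step_def)
  then show ?thesis
    using reach_Seq_left[OF assms(1)] assms(2) reach_step reach_trans by metis
qed

lemma reach_Asg: "reach (Asg d s m, \<sigma>) (Skip, \<sigma>(d := upd m (\<sigma> s)))"
  by (rule reach_step) (simp add: step_def apply_op_def reach_refl)

lemma reach_While_False: "\<sigma> r = 0 \<Longrightarrow> reach (While r c, \<sigma>) (Skip, \<sigma>)"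
  by (rule reach_step) (simp add: step_def reach_refl)

lemma reach_While_True:
  assumes "\<sigma> r > 0" "reach (c, \<sigma>) (Skip, \<sigma>')" "reach (While r c, \<sigma>') Y"
  shows "reach (While r c, \<sigma>) Y"
proof (rule reach_step)
  have "step (While r c, \<sigma>) = (Seq c (While r c), \<sigma>)" using assms(1) by (simp add: step_def)
  then show "reach (step (While r c, \<sigma>)) Y" using reach_Seq[OF assms(2,3)] by simp
qed

section \<open>The compiler and its correctness\<close>

text \<open>\<open>compile f xs d k\<close> reads its arguments from the registers \<open>xs\<close>, writes the value to \<open>d\<close>
  and uses the registers from \<open>k\<close> on as scratch space.\<close>

fun compile :: "recf \<Rightarrow> nat list \<Rightarrow> nat \<Rightarrow> nat \<Rightarrow> com"
  and compiles :: "recf list \<Rightarrow> nat list \<Rightarrow> nat \<Rightarrow> nat \<Rightarrow> com" where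
  "compile Zero xs d k = Asg d 0 Clr"
| "compile Succ xs d k = Asg d (xs ! 0) Inc"
| "compile (Proj i) xs d k = Asg d (xs ! i) Cpy"
| "compile (Comp f gs) xs d k =
    Seq (compiles gs xs k (k + length gs))
      (compile f [k..<k + length gs] d (k + length gs))"
| "compile (PrimRec f g) xs d k =
    Seq (Asg k (xs ! 0) Cpy) (Seq (Asg (k + 1) 0 Clr) (Seq (compile f (tl xs) (k + 2) (k + 4))
      (Seq
        (While k
          (Seq (compile g ((k + 1) # (k + 2) # tl xs) (k + 3) (k + 4))
            (Seq (Asg (k + 2) (k + 3) Cpy) (Seq (Asg (k + 1) (k + 1) Inc) (Asg k k Dec)))))
        (Asg d (k + 2) Cpy))))"
| "compile (Mu f) xs d k =
    Seq (Asg k 0 Clr) (Seq (compile f (k # xs) (k + 1) (k + 2))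
      (Seq
        (While (k + 1) (Seq (Asg k k Inc) (compile f (k # xs) (k + 1) (k + 2))))
        (Asg d k Cpy)))"
| "compiles [] xs d k = Skip"
| "compiles (g # gs) xs d k = Seq (compile g xs d k) (compiles gs xs (Suc d) k)"

text \<open>The last conjunct is the frame condition: a caller may keep its own variables in the
  registers below \<open>k\<close>.\<close>

definition implements :: "recf \<Rightarrow> nat list \<Rightarrow> nat \<Rightarrow> bool" where
  "implements f ys z \<longleftrightarrow> (\<forall>xs d k \<sigma>. map \<sigma> xs = ys \<longrightarrow> (\<forall>x\<in>set xs. x < k) \<longrightarrow> d < k \<longrightarrow>
    (\<exists>\<sigma>'. reach (compile f xs d k, \<sigma>) (Skip, \<sigma>') \<and> \<sigma>' d = z \<and>
      (\<forall>r<k. r \<noteq> d \<longrightarrow> \<sigma>' r = \<sigma> r)))"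

lemma implementsD:
  assumes "implements f ys z" "map \<sigma> xs = ys" "\<And>x. x \<in> set xs \<Longrightarrow> x < k" "d < k"
  obtains \<sigma>' where "reach (compile f xs d k, \<sigma>) (Skip, \<sigma>')" "\<sigma>' d = z"
    "\<And>r. r < k \<Longrightarrow> r \<noteq> d \<Longrightarrow> \<sigma>' r = \<sigma> r"
  using assms unfolding implements_def by blast

text \<open>Arguments lie below \<open>d\<close> and scratch space above all results, so no call
  destroys an argument or an earlier result.\<close>

lemma implements_compiles:
  assumes "list_all2 (\<lambda>g y. implements g ys y) gs vs" "map \<sigma> xs = ys"
    "\<And>x. x \<in> set xs \<Longrightarrow> x < d" "d + length gs \<le> k"
  shows "\<exists>\<sigma>'. reach (compiles gs xs d k, \<sigma>) (Skip, \<sigma>') \<and>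
    map \<sigma>' [d..<d + length gs] = vs \<and> (\<forall>r<d. \<sigma>' r = \<sigma> r)"
  using assms
proof (induction gs arbitrary: vs d \<sigma>)
  case Nil
  then show ?case by (auto intro: reach_refl)
next
  case (Cons g gs)
  from Cons.prems(1) obtain v vs' where vs: "vs = v # vs'" and g: "implements g ys v"
    and gs: "list_all2 (\<lambda>g y. implements g ys y) gs vs'"
    by (auto simp: list_all2_Cons1)
  obtain \<sigma>1 where s1: "reach (compile g xs d k, \<sigma>) (Skip, \<sigma>1)" "\<sigma>1 d = v"
    "\<And>r. r < k \<Longrightarrow> r \<noteq> d \<Longrightarrow> \<sigma>1 r = \<sigma> r"
    by (rule implementsD[OF g Cons.prems(2), of k d]) (use Cons.prems(3,4) in \<open>fastforce+\<close>)
  have "map \<sigma>1 xs = map \<sigma> xs"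
    using s1(3) Cons.prems(3,4) by (fastforce intro: map_cong)
  then have "map \<sigma>1 xs = ys" using Cons.prems(2) by simp
  from Cons.IH[OF gs this, of "Suc d"] Cons.prems(3,4)
  obtain \<sigma>2 where s2: "reach (compiles gs xs (Suc d) k, \<sigma>1) (Skip, \<sigma>2)"
    "map \<sigma>2 [Suc d..<Suc d + length gs] = vs'" "\<forall>r<Suc d. \<sigma>2 r = \<sigma>1 r"
    by (fastforce simp: less_Suc_eq)
  have "reach (compiles (g # gs) xs d k, \<sigma>) (Skip, \<sigma>2)"
    using reach_Seq[OF s1(1) s2(1)] by simp
  moreover have "map \<sigma>2 [d..<d + length (g # gs)] = vs"
    using s1(2) s2(2,3) vs by (simp add: upt_conv_Cons del: upt_Suc)
  moreover have "\<forall>r<d. \<sigma>2 r = \<sigma> r"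
    using s1(3) s2(3) Cons.prems(4) by auto
  ultimately show ?case by blast
qed

definition rec_chain :: "recf \<Rightarrow> recf \<Rightarrow> nat \<Rightarrow> nat list \<Rightarrow> nat \<Rightarrow> bool" where
  "rec_chain f g n ys z \<longleftrightarrow> (\<exists>v. v n = z \<and> implements f ys (v 0) \<and>
    (\<forall>i<n. implements g (i # v i # ys) (v (Suc i))))"

lemma implements_PrimRec:
  assumes "rec_chain f g n ys z"
  shows "implements (PrimRec f g) (n # ys) z"
  unfolding implements_def
proof (intro allI impI)
  fix xs :: "nat list" and d k :: nat and \<sigma> :: "nat \<Rightarrow> nat"
  assume xs: "map \<sigma> xs = n # ys" and k: "\<forall>x\<in>set xs. x < k" and d: "d < k"
  obtain x xs' where x: "xs = x # xs'" "\<sigma> x = n" "map \<sigma> xs' = ys"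
    using xs by (cases xs) auto
  from assms obtain v where v: "v n = z" "implements f ys (v 0)"
    "\<And>i. i < n \<Longrightarrow> implements g (i # v i # ys) (v (Suc i))"
    unfolding rec_chain_def by blast
  define body where "body = Seq (compile g ((k + 1) # (k + 2) # xs') (k + 3) (k + 4))
            (Seq (Asg (k + 2) (k + 3) Cpy) (Seq (Asg (k + 1) (k + 1) Inc) (Asg k k Dec)))"
  have small: "\<And>r. r \<in> set xs' \<Longrightarrow> r < k" using k x by auto
  \<comment> \<open>Invariant after \<open>i\<close> rounds: register \<open>k\<close> counts the
    remaining rounds, \<open>k + 1\<close> holds the index and \<open>k + 2\<close> the value
    \<open>v i\<close>.\<close>
  have loop: "\<exists>\<sigma>'. reach (While k body, \<tau>) (Skip, \<sigma>') \<and> \<sigma>' (k + 2) = z \<and> (\<forall>r<k. \<sigma>' r = \<tau> r)"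
    if "i \<le> n" "\<tau> k = n - i" "\<tau> (k + 1) = i" "\<tau> (k + 2) = v i" "\<forall>r<k. \<tau> r = \<sigma> r" for i \<tau>
    using that
  proof (induction "n - i" arbitrary: i \<tau>)
    case 0
    then show ?case using v(1) by (metis diff_is_0_eq diff_diff_cancel diff_zero reach_While_False)
  next
    case (Suc m)
    then have i: "i < n" by simp
    have "map \<tau> ((k + 1) # (k + 2) # xs') = i # v i # ys"
      using Suc.prems x small by auto
    then obtain \<tau>1 where t1: "reach (compile g ((k + 1) # (k + 2) # xs') (k + 3) (k + 4), \<tau>) (Skip, \<tau>1)"
      "\<tau>1 (k + 3) = v (Suc i)" "\<And>r. r < k + 4 \<Longrightarrow> r \<noteq> k + 3 \<Longrightarrow> \<tau>1 r = \<tau> r"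
      by (rule implementsD[OF v(3)[OF i], of _ _ "k + 4" "k + 3"]) (use small in \<open>fastforce+\<close>)
    define \<tau>2 where "\<tau>2 = \<tau>1(k + 2 := \<tau>1 (k + 3))"
    define \<tau>3 where "\<tau>3 = \<tau>2(k + 1 := Suc (\<tau>2 (k + 1)))"
    define \<tau>4 where "\<tau>4 = \<tau>3(k := \<tau>3 k - 1)"
    have body: "reach (body, \<tau>) (Skip, \<tau>4)"
      unfolding body_def
      apply (rule reach_Seq[OF t1(1)])
      apply (rule reach_Seq[OF reach_Asg])
      apply (rule reach_Seq[OF reach_Asg])
      using reach_Asg[of k k Dec \<tau>3] by (simp add: \<tau>4_def \<tau>3_def \<tau>2_def)
    have "\<exists>\<sigma>'. reach (While k body, \<tau>4) (Skip, \<sigma>') \<and> \<sigma>' (k + 2) = z \<and> (\<forall>r<k. \<sigma>' r = \<tau>4 r)"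
      by (rule Suc.hyps(1)[of "Suc i"])
        (use Suc.hyps(2) Suc.prems t1 i in \<open>auto simp: \<tau>4_def \<tau>3_def \<tau>2_def\<close>)
    then obtain \<sigma>' where s: "reach (While k body, \<tau>4) (Skip, \<sigma>')" "\<sigma>' (k + 2) = z"
      "\<forall>r<k. \<sigma>' r = \<tau>4 r" by blast
    have "reach (While k body, \<tau>) (Skip, \<sigma>')"
      by (rule reach_While_True[OF _ body s(1)]) (use Suc.prems i in simp)
    moreover have "\<forall>r<k. \<tau>4 r = \<tau> r"
      using t1(3) by (auto simp: \<tau>4_def \<tau>3_def \<tau>2_def)
    ultimately show ?case using s by (intro exI[of _ \<sigma>']) simp
  qed
  define \<sigma>1 where "\<sigma>1 = \<sigma>(k := n)"
  define \<sigma>2 where "\<sigma>2 = \<sigma>1(k + 1 := 0)"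
  have "map \<sigma>2 xs' = ys" using x small by (force simp: \<sigma>2_def \<sigma>1_def)
  then obtain \<sigma>3 where s3: "reach (compile f xs' (k + 2) (k + 4), \<sigma>2) (Skip, \<sigma>3)"
    "\<sigma>3 (k + 2) = v 0" "\<And>r. r < k + 4 \<Longrightarrow> r \<noteq> k + 2 \<Longrightarrow> \<sigma>3 r = \<sigma>2 r"
    by (rule implementsD[OF v(2), of _ _ "k + 4" "k + 2"]) (use small in \<open>fastforce+\<close>)
  have "\<exists>\<sigma>'. reach (While k body, \<sigma>3) (Skip, \<sigma>') \<and> \<sigma>' (k + 2) = z \<and> (\<forall>r<k. \<sigma>' r = \<sigma>3 r)"
    by (rule loop[of 0]) (use s3 in \<open>auto simp: \<sigma>2_def \<sigma>1_def\<close>)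
  then obtain \<sigma>4 where s4: "reach (While k body, \<sigma>3) (Skip, \<sigma>4)" "\<sigma>4 (k + 2) = z"
    "\<forall>r<k. \<sigma>4 r = \<sigma>3 r" by blast
  have "reach (compile (PrimRec f g) xs d k, \<sigma>) (Skip, \<sigma>4(d := z))"
    unfolding compile.simps
    apply (rule reach_Seq[OF reach_Asg])
    apply (rule reach_Seq[OF reach_Asg])
    apply (rule reach_Seq[where \<sigma>' = \<sigma>3])
    subgoal using s3(1) x by (simp add: \<sigma>2_def \<sigma>1_def)
    apply (rule reach_Seq[where \<sigma>' = \<sigma>4])
    subgoal using s4(1) x by (simp add: body_def)
    using reach_Asg[of d "k + 2" Cpy \<sigma>4] s4(2) by simp
  moreover have "\<forall>r<k. \<sigma>4 r = \<sigma> r"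
    using s4(3) s3(3) by (auto simp: \<sigma>2_def \<sigma>1_def)
  ultimately show "\<exists>\<sigma>'. reach (compile (PrimRec f g) xs d k, \<sigma>) (Skip, \<sigma>') \<and> \<sigma>' d = z \<and>
      (\<forall>r<k. r \<noteq> d \<longrightarrow> \<sigma>' r = \<sigma> r)"
    by (intro exI[of _ "\<sigma>4(d := z)"]) simp
qed

lemma implements_Mu:
  assumes v: "\<And>i. i \<le> n \<Longrightarrow> implements f (i # ys) (v i)" and "v n = 0"
    and pos: "\<And>i. i < n \<Longrightarrow> v i > 0"
  shows "implements (Mu f) ys n"
  unfolding implements_def
proof (intro allI impI)
  fix xs :: "nat list" and d k :: nat and \<sigma> :: "nat \<Rightarrow> nat"
  assume xs: "map \<sigma> xs = ys" and k: "\<forall>x\<in>set xs. x < k" and d: "d < k"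
  have call: "\<exists>\<tau>'. reach (compile f (k # xs) (k + 1) (k + 2), \<tau>) (Skip, \<tau>') \<and>
      \<tau>' (k + 1) = v i \<and> \<tau>' k = i \<and> (\<forall>r<k. \<tau>' r = \<sigma> r)"
    if le: "i \<le> n" and \<tau>: "\<tau> k = i" "\<forall>r<k. \<tau> r = \<sigma> r" for i \<tau>
  proof -
    have "map \<tau> (k # xs) = i # ys" using \<tau> k xs by auto
    then obtain \<tau>' where t: "reach (compile f (k # xs) (k + 1) (k + 2), \<tau>) (Skip, \<tau>')"
      "\<tau>' (k + 1) = v i" "\<And>r. r < k + 2 \<Longrightarrow> r \<noteq> k + 1 \<Longrightarrow> \<tau>' r = \<tau> r"
      by (rule implementsD[OF v[OF le], of _ _ "k + 2" "k + 1"]) (use k in \<open>fastforce+\<close>)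
    then show ?thesis using \<tau> by (intro exI[of _ \<tau>']) auto
  qed
  define body where "body = Seq (Asg k k Inc) (compile f (k # xs) (k + 1) (k + 2))"
  \<comment> \<open>Register \<open>k\<close> holds the candidate and \<open>k + 1\<close> the value
    of \<open>f\<close> there; the loop stops at the first zero.\<close>
  have loop: "\<exists>\<sigma>'. reach (While (k + 1) body, \<tau>) (Skip, \<sigma>') \<and> \<sigma>' k = n \<and> (\<forall>r<k. \<sigma>' r = \<sigma> r)"
    if "i \<le> n" "\<tau> k = i" "\<tau> (k + 1) = v i" "\<forall>r<k. \<tau> r = \<sigma> r" for i \<tau>
    using that
  proof (induction "n - i" arbitrary: i \<tau>)
    case 0
    then have "i = n" by simp
    then show ?case using 0 \<open>v n = 0\<close> reach_While_False[of \<tau> "k + 1" body]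
      by (intro exI[of _ \<tau>]) simp
  next
    case (Suc m)
    then have i: "i < n" by simp
    have "\<exists>\<tau>'. reach (compile f (k # xs) (k + 1) (k + 2), \<tau>(k := Suc i)) (Skip, \<tau>') \<and>
      \<tau>' (k + 1) = v (Suc i) \<and> \<tau>' k = Suc i \<and> (\<forall>r<k. \<tau>' r = \<sigma> r)"
      by (rule call) (use Suc.prems i in auto)
    then obtain \<tau>' where t: "reach (compile f (k # xs) (k + 1) (k + 2), \<tau>(k := Suc i)) (Skip, \<tau>')"
      "\<tau>' (k + 1) = v (Suc i)" "\<tau>' k = Suc i" "\<forall>r<k. \<tau>' r = \<sigma> r" by blast
    have "reach (body, \<tau>) (Skip, \<tau>')"
      unfolding body_def
      by (rule reach_Seq[OF reach_Asg]) (use t(1) Suc.prems in simp)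
    moreover have "\<exists>\<sigma>'. reach (While (k + 1) body, \<tau>') (Skip, \<sigma>') \<and> \<sigma>' k = n \<and> (\<forall>r<k. \<sigma>' r = \<sigma> r)"
      by (rule Suc.hyps(1)[of "Suc i"]) (use t i Suc.hyps(2) in auto)
    moreover have "\<tau> (k + 1) > 0" using pos[OF i] Suc.prems by simp
    ultimately show ?case by (metis reach_While_True)
  qed
  have "\<exists>\<tau>'. reach (compile f (k # xs) (k + 1) (k + 2), \<sigma>(k := 0)) (Skip, \<tau>') \<and>
      \<tau>' (k + 1) = v 0 \<and> \<tau>' k = 0 \<and> (\<forall>r<k. \<tau>' r = \<sigma> r)"
    by (rule call) auto
  then obtain \<tau>0 where t0: "reach (compile f (k # xs) (k + 1) (k + 2), \<sigma>(k := 0)) (Skip, \<tau>0)"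
    "\<tau>0 (k + 1) = v 0" "\<tau>0 k = 0" "\<forall>r<k. \<tau>0 r = \<sigma> r" by blast
  obtain \<sigma>1 where s1: "reach (While (k + 1) body, \<tau>0) (Skip, \<sigma>1)" "\<sigma>1 k = n"
    "\<forall>r<k. \<sigma>1 r = \<sigma> r"
    using loop[of 0 \<tau>0] t0 by auto
  have "reach (compile (Mu f) xs d k, \<sigma>) (Skip, \<sigma>1(d := n))"
    unfolding compile.simps
    apply (rule reach_Seq[OF reach_Asg])
    apply (rule reach_Seq[where \<sigma>' = \<tau>0])
    subgoal using t0(1) by simp
    apply (rule reach_Seq[where \<sigma>' = \<sigma>1])
    subgoal using s1(1) by (simp add: body_def)
    using reach_Asg[of d k Cpy \<sigma>1] s1(2) by simp
  then show "\<exists>\<sigma>'. reach (compile (Mu f) xs d k, \<sigma>) (Skip, \<sigma>') \<and> \<sigma>' d = n \<and>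
      (\<forall>r<k. r \<noteq> d \<longrightarrow> \<sigma>' r = \<sigma> r)"
    using s1(3) by (intro exI[of _ "\<sigma>1(d := n)"]) simp
qed

text \<open>The second conjunct makes the invariant of the loop for \<open>PrimRec\<close> available, which the
  statement about the value alone does not provide.\<close>

lemma recf_eval_implements_aux:
  "recf_eval h ys z \<Longrightarrow> implements h ys z \<and>
    (\<forall>f g n xs. h = PrimRec f g \<longrightarrow> ys = n # xs \<longrightarrow> rec_chain f g n xs z)"
proof (induction h ys z rule: recf_eval.induct)
  case (Zero xs)
  have "\<exists>\<sigma>'. reach (compile Zero xs d k, \<sigma>) (Skip, \<sigma>') \<and> \<sigma>' d = 0 \<and>
      (\<forall>r<k. r \<noteq> d \<longrightarrow> \<sigma>' r = \<sigma> r)" for xs d k \<sigma>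
    using reach_Asg[of d 0 Clr \<sigma>] by (intro exI[of _ "\<sigma>(d := 0)"]) simp
  then show ?case unfolding implements_def by blast
next
  case (Succ x)
  show ?case unfolding implements_def
  proof (intro conjI allI impI)
    fix xs :: "nat list" and d k :: nat and \<sigma> :: "nat \<Rightarrow> nat"
    assume "map \<sigma> xs = [x]" "\<forall>x\<in>set xs. x < k" "d < k"
    then have "\<sigma> (xs ! 0) = x" by auto
    then show "\<exists>\<sigma>'. reach (compile Succ xs d k, \<sigma>) (Skip, \<sigma>') \<and> \<sigma>' d = Suc x \<and>
        (\<forall>r<k. r \<noteq> d \<longrightarrow> \<sigma>' r = \<sigma> r)"
      using reach_Asg[of d "xs ! 0" Inc \<sigma>] by (intro exI[of _ "\<sigma>(d := Suc x)"]) simp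
  qed auto
next
  case (Proj i ys)
  show ?case unfolding implements_def
  proof (intro conjI allI impI)
    fix xs :: "nat list" and d k :: nat and \<sigma> :: "nat \<Rightarrow> nat"
    assume xs: "map \<sigma> xs = ys" "\<forall>x\<in>set xs. x < k" "d < k"
    then have "\<sigma> (xs ! i) = ys ! i" using Proj by auto
    then show "\<exists>\<sigma>'. reach (compile (Proj i) xs d k, \<sigma>) (Skip, \<sigma>') \<and> \<sigma>' d = ys ! i \<and>
        (\<forall>r<k. r \<noteq> d \<longrightarrow> \<sigma>' r = \<sigma> r)"
      using reach_Asg[of d "xs ! i" Cpy \<sigma>] by (intro exI[of _ "\<sigma>(d := ys ! i)"]) simp
  qed auto
next
  case (Comp ys gs vs f z)
  have gs: "list_all2 (\<lambda>g y. implements g ys y) gs vs"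
    using Comp.IH(1) by (rule list_all2_mono) (elim conjunct1 conjE)
  show ?case unfolding implements_def[of "Comp f gs"]
  proof (intro conjI allI impI)
    fix xs :: "nat list" and d k :: nat and \<sigma> :: "nat \<Rightarrow> nat"
    assume xs: "map \<sigma> xs = ys" "\<forall>x\<in>set xs. x < k" "d < k"
    obtain \<sigma>1 where s1: "reach (compiles gs xs k (k + length gs), \<sigma>) (Skip, \<sigma>1)"
      "map \<sigma>1 [k..<k + length gs] = vs" "\<forall>r<k. \<sigma>1 r = \<sigma> r"
      using implements_compiles[OF gs xs(1)] xs(2) by blast
    have "implements f vs z" using Comp.IH(2) by (rule conjunct1)
    then have "\<exists>\<sigma>'. reach (compile f [k..<k + length gs] d (k + length gs), \<sigma>1) (Skip, \<sigma>') \<and>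
        \<sigma>' d = z \<and> (\<forall>r<k + length gs. r \<noteq> d \<longrightarrow> \<sigma>' r = \<sigma>1 r)"
      unfolding implements_def using s1(2) xs(3) by simp
    then obtain \<sigma>2 where s2:
      "reach (compile f [k..<k + length gs] d (k + length gs), \<sigma>1) (Skip, \<sigma>2)"
      "\<sigma>2 d = z" "\<And>r. r < k + length gs \<Longrightarrow> r \<noteq> d \<Longrightarrow> \<sigma>2 r = \<sigma>1 r"
      by blast
    show "\<exists>\<sigma>'. reach (compile (Comp f gs) xs d k, \<sigma>) (Skip, \<sigma>') \<and> \<sigma>' d = z \<and>
        (\<forall>r<k. r \<noteq> d \<longrightarrow> \<sigma>' r = \<sigma> r)"
      using reach_Seq[OF s1(1) s2(1)] s2(2,3) s1(3) by (intro exI[of _ \<sigma>2]) simp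
  qed auto
next
  case (PrimRec_0 f xs y g)
  have "implements f xs y" using PrimRec_0.IH by (rule conjunct1)
  then have chain: "rec_chain f g 0 xs y"
    unfolding rec_chain_def by (intro exI[of _ "\<lambda>_. y"]) simp
  show ?case using implements_PrimRec[OF chain] chain by simp
next
  case (PrimRec_Suc f g n xs y z)
  have "rec_chain f g n xs y" using PrimRec_Suc.IH(1) by simp
  moreover have g: "implements g (n # y # xs) z" using PrimRec_Suc.IH(2) by (rule conjunct1)
  ultimately obtain v where "v n = y" "implements f xs (v 0)"
    "\<forall>i<n. implements g (i # v i # xs) (v (Suc i))"
    unfolding rec_chain_def by blast
  then have chain: "rec_chain f g (Suc n) xs z"
    unfolding rec_chain_def using g
    by (intro exI[of _ "v(Suc n := z)"]) (simp add: less_Suc_eq all_conj_distrib)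
  show ?case using implements_PrimRec[OF chain] chain by simp
next
  case (Mu f n xs)
  have f0: "implements f (n # xs) 0" using Mu.IH(1) by (rule conjunct1)
  have "\<exists>k. implements f (m # xs) (Suc k)" if "m < n" for m
  proof -
    from Mu.IH(2)[rule_format, OF that] obtain k where "implements f (m # xs) (Suc k)"
      by (elim exE conjE)
    then show ?thesis ..
  qed
  then obtain w where w: "\<And>m. m < n \<Longrightarrow> implements f (m # xs) (Suc (w m))" by metis
  have "implements (Mu f) xs n"
  proof (rule implements_Mu[where v = "\<lambda>i. if i < n then Suc (w i) else 0"])
    fix i
    assume "i \<le> n"
    then show "implements f (i # xs) (if i < n then Suc (w i) else 0)"
      using w[of i] f0 by (cases "i = n") simp_all
  qed simp_all
  then show ?case by simp
qed

lemma recf_eval_implements: "recf_eval f ys z \<Longrightarrow> implements f ys z"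
  using recf_eval_implements_aux by blast

text \<open>Register \<open>1\<close> receives the answer. Register \<open>2\<close> is set to one
  and cleared again if the answer is positive, so the last loop runs forever exactly when the answer
  is zero.\<close>

definition decider :: "recf \<Rightarrow> com" where
  "decider f = Seq (compile f [0] 1 2) (Seq (Asg 2 0 Clr) (Seq (Asg 2 2 Inc)
    (Seq (While 1 (Seq (Asg 1 1 Clr) (Asg 2 2 Clr))) (While 2 Skip))))"

lemma decider_halts:
  assumes "recf_eval f [x] z"
  shows "(\<exists>k. fst ((step ^^ k) (decider f, (\<lambda>_. 0)(0 := x))) = Skip) \<longleftrightarrow> z > 0"
proof -
  let ?X = "(decider f, (\<lambda>_. 0)(0 := x))"
  obtain \<sigma> where s: "reach (compile f [0] 1 2, (\<lambda>_. 0)(0 := x)) (Skip, \<sigma>)" "\<sigma> 1 = z"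
    by (rule implementsD[OF recf_eval_implements[OF assms], of "(\<lambda>_. 0)(0 := x)" "[0]" 2 1]) auto
  define L where "L = Seq (While 1 (Seq (Asg 1 1 Clr) (Asg 2 2 Clr))) (While 2 Skip)"
  define \<sigma>1 where "\<sigma>1 = \<sigma>(2 := 1)"
  have toL: "reach ?X Y" if "reach (L, \<sigma>1) Y" for Y
    unfolding decider_def L_def[symmetric]
    apply (rule reach_Seq[OF s(1)])
    apply (rule reach_Seq[OF reach_Asg])
    apply (rule reach_Seq[OF reach_Asg])
    using that by (simp add: \<sigma>1_def)
  show ?thesis
  proof (cases "z = 0")
    case True
    have "reach (L, \<sigma>1) (While 2 Skip, \<sigma>1)"
      unfolding L_def
      by (rule reach_Seq[OF reach_While_False reach_refl]) (use s True in \<open>simp add: \<sigma>1_def\<close>)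
    then obtain k0 where k0: "(step ^^ k0) ?X = (While 2 Skip, \<sigma>1)"
      using toL unfolding reach_def by blast
    have st: "step (While 2 Skip, \<sigma>1) = (Seq Skip (While 2 Skip), \<sigma>1)"
      "step (Seq Skip (While 2 Skip), \<sigma>1) = (While 2 Skip, \<sigma>1)"
      by (simp_all add: step_def \<sigma>1_def)
    have loop: "(step ^^ k) (While 2 Skip, \<sigma>1) \<in>
        {(While 2 Skip, \<sigma>1), (Seq Skip (While 2 Skip), \<sigma>1)}" for k
      by (induction k) (auto simp: st)
    \<comment> \<open>\<open>Skip\<close> is absorbing and powers of \<open>step\<close> commute, so
      halting would put \<open>Skip\<close> on the cycle of two commands just found.\<close>
    have "fst ((step ^^ k) ?X) \<noteq> Skip" for k
    proof
      assume "fst ((step ^^ k) ?X) = Skip"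
      then obtain \<tau> where "(step ^^ k) ?X = (Skip, \<tau>)" by (cases "(step ^^ k) ?X") simp
      then have "fst ((step ^^ k0) ((step ^^ k) ?X)) = Skip" by simp
      moreover have "(step ^^ k0) ((step ^^ k) ?X) = (step ^^ k) ((step ^^ k0) ?X)"
        by (metis add.commute comp_apply funpow_add)
      then have "(step ^^ k0) ((step ^^ k) ?X) = (step ^^ k) (While 2 Skip, \<sigma>1)"
        by (simp only: k0)
      ultimately show False using loop[of k] by auto
    qed
    then show ?thesis using True by auto
  next
    case False
    have body: "reach (Seq (Asg 1 1 Clr) (Asg 2 2 Clr), \<sigma>1) (Skip, \<sigma>1(1 := 0, 2 := 0))"
      by (rule reach_Seq[OF reach_Asg]) (use reach_Asg[of 2 2 Clr] in simp)
    have "reach (L, \<sigma>1) (Skip, \<sigma>1(1 := 0, 2 := 0))"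
      unfolding L_def
    proof (rule reach_Seq[where \<sigma>' = "\<sigma>1(1 := 0, 2 := 0)"])
      show "reach (While 1 (Seq (Asg 1 1 Clr) (Asg 2 2 Clr)), \<sigma>1) (Skip, \<sigma>1(1 := 0, 2 := 0))"
        by (rule reach_While_True[OF _ body reach_While_False])
          (use False s in \<open>auto simp: \<sigma>1_def\<close>)
    qed (rule reach_While_False, simp)
    then have "reach ?X (Skip, \<sigma>1(1 := 0, 2 := 0))" by (rule toL)
    then show ?thesis using False unfolding reach_def by (metis fst_conv neq0_conv)
  qed
qed

subsection \<open>The colouring rule on the horocyclic coordinates\<close>

text \<open>The effect of \<open>a\<close> or \<open>b\<close> on the lamps at height
  \<open>j\<close>: only \<open>b\<close> flips the lamp that it passes.\<close>

definition fl :: "bool \<Rightarrow> nat \<Rightarrow> nat \<Rightarrow> nat" where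
  "fl \<beta> j y = (if \<beta> then flip_bit j y else y)"

text \<open>\<open>Sea w e s n p q\<close> is a Wang tile at level \<open>0\<close>, where the edge colour \<open>None\<close> stands for the
  boundary of the quadrant, and \<open>p\<close>, \<open>q\<close> are the labels of the neighbours along \<open>a\<close> and
  \<open>a\<^sup>-\<^sup>1\<close>. \<open>Up x (Some (w, m, e))\<close> is a node above it that represents an interval of a row with
  outer edges \<open>w\<close>, \<open>e\<close> and middle edge \<open>m\<close>; \<open>Dn\<close> does the same below for columns.\<close>

datatype ('h, 'v) col =
    Sea "'h option" "'h option" "'v option" "'v option" bool bool
  | Up bool "('h option \<times> 'h option \<times> 'h option) option"
  | Dn bool "('v option \<times> 'v option \<times> 'v option) option"

fun swap :: "('h, 'v) col \<Rightarrow> ('v, 'h) col" where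
  "swap (Sea w e s n p q) = Sea s n w e q p"
| "swap (Up x I) = Dn x I"
| "swap (Dn x I) = Up x I"

text \<open>The label that the neighbour above along \<open>a\<close>, or along \<open>b\<close> if
  \<open>\<beta>\<close> holds, has to carry. A tile at level \<open>0\<close> sends out two
  different labels, a node above it passes on its own.\<close>

fun label :: "bool \<Rightarrow> ('h, 'v) col \<Rightarrow> bool option" where
  "label \<beta> (Sea w e s n p q) = Some (p \<noteq> \<beta>)"
| "label \<beta> (Up x I) = Some x"
| "label \<beta> (Dn x I) = None"

fun outer :: "('h, 'v) col \<Rightarrow> ('h option \<times> 'h option) option" where
  "outer (Sea w e s n p q) = Some (w, e)"
| "outer (Up x (Some (w, m, e))) = Some (w, e)"
| "outer _ = None"

text \<open>The second conjunct makes \<open>u\<close> the left half of the interval of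
  \<open>v\<close> along \<open>a\<close> and the right half along \<open>b\<close>. The third one
  continues the intervals that start at the boundary to every level, which creates the
  spine.\<close>

fun up_rule :: "bool \<Rightarrow> ('h, 'v) col \<Rightarrow> ('h, 'v) col \<Rightarrow> bool" where
  "up_rule \<beta> u (Up x I) \<longleftrightarrow> label \<beta> u = Some x \<and>
    (\<forall>w m e. I = Some (w, m, e) \<longrightarrow> outer u = Some (if \<beta> then (m, e) else (w, m))) \<and>
    (\<not> \<beta> \<and> (\<exists>e. outer u = Some (None, e)) \<longrightarrow> I \<noteq> None)"
| "up_rule \<beta> u _ \<longleftrightarrow> False"

text \<open>Below level \<open>0\<close> the roles of rows and columns are exchanged and the edges
  are read backwards.\<close>

definition rule :: "bool \<Rightarrow> ('h, 'v) col \<Rightarrow> ('h, 'v) col \<Rightarrow> bool" where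
  "rule \<beta> u v \<longleftrightarrow> up_rule \<beta> u v \<or> up_rule \<beta> (swap v) (swap u)"

lemma swap_swap [simp]: "swap (swap c) = c"
  by (cases c) auto

lemma rule_swap: "rule \<beta> (swap u) (swap v) \<longleftrightarrow> rule \<beta> v u"
  by (auto simp: rule_def)

lemma rule_Sea_right: "rule \<beta> (Sea w e s n p q) v \<Longrightarrow> \<exists>I. v = Up (p \<noteq> \<beta>) I"
  by (cases v) (auto simp: rule_def)

lemma rule_Up_right: "rule \<beta> (Up x I) v \<Longrightarrow> \<exists>J. v = Up x J"
  by (cases v) (auto simp: rule_def)

lemma rule_Up_left: "rule \<beta> u (Up x I) \<Longrightarrow>
    (\<exists>J. u = Up x J) \<or> (\<exists>w e s n p q. u = Sea w e s n p q \<and> x = (p \<noteq> \<beta>))"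
  by (cases u) (auto simp: rule_def)

lemma rule_Up_iff: "rule \<beta> u (Up x I) \<longleftrightarrow> up_rule \<beta> u (Up x I)"
  by (cases u) (auto simp: rule_def)

lemma rule_interval: "rule \<beta> u (Up x (Some (w, m, e))) \<Longrightarrow>
    outer u = Some (if \<beta> then (m, e) else (w, m))"
  by (simp add: rule_Up_iff)

lemma rule_spine: "rule False u v \<Longrightarrow> outer u = Some (None, e) \<Longrightarrow>
    \<exists>x m e'. v = Up x (Some (None, m, e'))"
  by (cases u; cases v) (auto simp: rule_def)

lemma fl_simps [simp]: "fl False j y = y" "fl True j y = flip_bit j y"
  by (simp_all add: fl_def)

lemma bit_fl: "bit (fl \<beta> j y) i \<longleftrightarrow> (bit y i \<noteq> (i = j \<and> \<beta>))" for y :: nat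
  by (auto simp: fl_def bit_flip_bit_iff)

lemma fl_fl [simp]: "fl \<beta> j (fl \<beta> j y) = y"
  by (rule bit_eqI) (auto simp: bit_fl)

lemma less_power2_iff: "(y::nat) < 2 ^ N \<longleftrightarrow> (\<forall>i\<ge>N. \<not> bit y i)"
  by (metis bit_take_bit_iff leD linorder_not_le take_bit_nat_eq_self_iff bit_eqI take_bit_nat_eq_self)

lemma dvd_power2_iff: "2 ^ N dvd (y::nat) \<longleftrightarrow> (\<forall>i<N. \<not> bit y i)"
proof -
  have "2 ^ N dvd y \<longleftrightarrow> take_bit N y = 0" by (simp add: take_bit_eq_0_iff)
  also have "\<dots> \<longleftrightarrow> (\<forall>i<N. \<not> bit y i)"
    by (metis bit_0_eq bit_eqI bit_take_bit_iff bot_apply bot_bool_def)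
  finally show ?thesis .
qed

lemma fl_less: "y < 2 ^ N \<Longrightarrow> j < N \<Longrightarrow> fl \<beta> j y < 2 ^ N"
  by (auto simp: less_power2_iff bit_fl)

lemma odd_fl: "odd (fl \<beta> j y) \<longleftrightarrow> (odd y \<noteq> (j = 0 \<and> \<beta>))"
  using bit_fl[of \<beta> j y 0] by (simp add: bit_0)

lemma fl_unset: "\<not> bit y j \<Longrightarrow> flip_bit j y = y + 2 ^ j" for y :: nat
  by (simp add: flip_bit_eq_if set_bit_eq)

text \<open>The right half of a dyadic interval starts at a number whose lowest set bit is bit
  \<open>j\<close>; flipping that bit leads to the start of the whole interval.\<close>

lemma flip_odd_multiple: "flip_bit j ((2 * k + 1) * 2 ^ j) = k * (2::nat) ^ Suc j"
proof -
  have "flip_bit j (k * 2 ^ Suc j) = k * 2 ^ Suc j + (2::nat) ^ j"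
    by (rule fl_unset) (use dvd_power2_iff[of "Suc j" "k * 2 ^ Suc j"] in simp)
  also have "\<dots> = (2 * k + 1) * 2 ^ j" by (simp add: algebra_simps)
  finally show ?thesis
    by (metis fl_fl fl_simps(2))
qed

fun is_sea :: "('h, 'v) col \<Rightarrow> bool" where
  "is_sea (Sea _ _ _ _ _ _) = True" | "is_sea _ = False"
fun west where "west (Sea w e s n p q) = w"
fun east where "east (Sea w e s n p q) = e"
fun south where "south (Sea w e s n p q) = s"
fun north where "north (Sea w e s n p q) = n"

section \<open>From the colouring rule to the matching condition on a row\<close>

context
  fixes f :: "nat \<Rightarrow> nat \<Rightarrow> ('h, 'v) col" and w e s n p q
  assumes rule: "\<And>\<beta> y j. rule \<beta> (f y j) (f (fl \<beta> j y) (Suc j))"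
    and origin: "f 0 0 = Sea w e s n p q"
begin

text \<open>The parity of the row coordinate, copied upwards from level \<open>1\<close>, is what forces the sea
  level: above level \<open>0\<close> both upper neighbours of a node carry the same label, while the upper
  neighbours of a node at level \<open>0\<close> carry different labels.\<close>

lemma upper_label_top:
  assumes "y < 2 ^ Suc N"
  shows "\<exists>I. f y (Suc N) = Up (p \<noteq> odd y) I"
  using assms
proof (induction N arbitrary: y)
  case 0
  then consider "y = 0" | "y = fl True 0 0" by (auto simp: less_2_cases_iff flip_bit_0)
  then show ?case
  proof cases
    case 1
    then show ?thesis using rule[of False 0 0] origin rule_Sea_right by fastforce
  next
    case 2
    then show ?thesis using rule[of True 0 0] origin rule_Sea_right
      by (fastforce simp: odd_fl simp del: fl_simps)
  qed
next
  case (Suc N)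
  \<comment> \<open>Clearing bit \<open>Suc N\<close> selects the neighbour below to which the
    induction hypothesis applies.\<close>
  have "fl (bit y (Suc N)) (Suc N) y < 2 ^ Suc N"
    using Suc.prems unfolding less_power2_iff bit_fl by (metis Suc_leI le_neq_implies_less)
  from Suc.IH[OF this] show ?case
    using rule[of "bit y (Suc N)" "fl (bit y (Suc N)) (Suc N) y" "Suc N"] rule_Up_right
    by (fastforce simp: odd_fl)
qed

text \<open>Downward induction from level \<open>N\<close>, where \<open>upper_label_top\<close>
  applies: equal labels on both upper neighbours exclude a sea node, and \<open>Up\<close> passes on
  its label unchanged.\<close>

lemma upper_label:
  assumes "y < 2 ^ N" "0 < j" "j \<le> N"
  shows "\<exists>I. f y j = Up (p \<noteq> odd y) I"
  using assms(3,1,2)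
proof (induction j arbitrary: y rule: inc_induct)
  case base
  then show ?case using upper_label_top[of y "N - 1"] by simp
next
  case (step j)
  obtain I where I: "f y (Suc j) = Up (p \<noteq> odd y) I"
    using step.IH[of y] step.prems by auto
  have "fl True j y < 2 ^ N" using fl_less step by blast
  then obtain J where J: "f (fl True j y) (Suc j) = Up (p \<noteq> odd y) J"
    using step.IH[of "fl True j y"] step.prems by (auto simp: odd_fl simp del: fl_simps)
  show ?case
    using rule_Up_left[OF rule[of False y j, simplified, unfolded I]]
      rule_Up_left[OF rule[of True y j, unfolded J]] by auto
qed

text \<open>The two neighbours at level \<open>1\<close> differ in parity and so in label, which no
  \<open>Up\<close> below them could produce.\<close>

lemma sea_level: "is_sea (f y 0)"
proof -
  have N: "y < 2 ^ Suc y" using less_exp[of "Suc y"] by simp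
  obtain I where I: "f y 1 = Up (p \<noteq> odd y) I"
    using upper_label[OF N, of 1] by auto
  have "fl True 0 y < 2 ^ Suc y" using fl_less N by blast
  then obtain J where J: "f (fl True 0 y) 1 = Up (p \<noteq> even y) J"
    using upper_label[of "fl True 0 y" "Suc y" 1] by (auto simp: odd_fl simp del: fl_simps)
  show ?thesis
    using rule_Up_left[OF rule[of False y 0, simplified, unfolded One_nat_def[symmetric] I]]
      rule_Up_left[OF rule[of True y 0, unfolded One_nat_def[symmetric] J]] by auto
qed

context
  assumes boundary: "w = None"
begin

lemma spine: "outer (f 0 j) = Some (None, snd (the (outer (f 0 j))))"
proof (induction j)
  case 0
  then show ?case using origin boundary by simp
next
  case (Suc j)
  from rule_spine[OF rule[of False 0 j] this] show ?case by auto
qed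

text \<open>The parity of \<open>y\<close> decides which half of its parent the node is. By
  \<open>upper_label\<close> the parent is an \<open>Up\<close>, so having an outer pair means that
  it stores an interval.\<close>

lemma parent_interval:
  assumes "outer (f (y div 2 * 2 ^ Suc j) (Suc j)) \<noteq> None"
  shows "\<exists>w m e. outer (f (y div 2 * 2 ^ Suc j) (Suc j)) = Some (w, e) \<and>
    f (y div 2 * 2 ^ Suc j) (Suc j) = Up (p \<noteq> odd (y div 2 * 2 ^ Suc j)) (Some (w, m, e)) \<and>
    outer (f (y * 2 ^ j) j) = Some (if odd y then (m, e) else (w, m))"
proof -
  obtain N where N: "y div 2 * 2 ^ Suc j < 2 ^ N" "Suc j \<le> N"
  proof
    show "y div 2 * 2 ^ Suc j < 2 ^ (y div 2 * 2 ^ Suc j + Suc j)"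
      by (rule less_le_trans[OF less_exp], rule power_increasing) simp_all
  qed simp
  obtain I where "f (y div 2 * 2 ^ Suc j) (Suc j) = Up (p \<noteq> odd (y div 2 * 2 ^ Suc j)) I"
    using upper_label[OF N(1) _ N(2)] by blast
  with assms obtain w' m' e' where
    I: "f (y div 2 * 2 ^ Suc j) (Suc j) = Up (p \<noteq> odd (y div 2 * 2 ^ Suc j)) (Some (w', m', e'))"
    by (cases I) auto
  have "fl (odd y) j (y * 2 ^ j) = y div 2 * 2 ^ Suc j"
  proof (cases "odd y")
    case True
    then show ?thesis using flip_odd_multiple[of j "y div 2"] by simp
  next
    case False
    then obtain k where "y = 2 * k" by blast
    then show ?thesis by simp
  qed
  then show ?thesis
    using rule_interval[OF rule[of "odd y" "y * 2 ^ j" j, unfolded \<open>fl _ _ _ = _\<close> I]] I by simp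
qed

text \<open>The spine node at level \<open>J\<close> stores an interval, and halving hands intervals
  down to all nodes under it.\<close>

lemma intervals:
  assumes "y < 2 ^ (J - j)" "j \<le> J"
  shows "outer (f (y * 2 ^ j) j) \<noteq> None"
  using assms(2,1)
proof (induction j arbitrary: y rule: inc_induct)
  case base
  have "outer (f 0 J) \<noteq> None" using spine[of J] by (metis option.distinct(1))
  then show ?case using base by simp
next
  case (step j)
  have "y div 2 < 2 ^ (J - Suc j)"
    using step.prems step.hyps(2)
    by (simp add: less_mult_imp_div_less Suc_diff_Suc flip: power_Suc2)
  from parent_interval[OF step.IH[OF this]] show ?case by force
qed

text \<open>For even \<open>y\<close> the two intervals are the halves of one parent and meet in its
  middle edge; for odd \<open>y\<close> their parents are adjacent and the induction hypothesis
  applies.\<close>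

lemma adjacent_intervals:
  assumes "Suc y < 2 ^ (J - j)" "j \<le> J"
  shows "snd (the (outer (f (y * 2 ^ j) j))) = fst (the (outer (f (Suc y * 2 ^ j) j)))"
  using assms(2,1)
proof (induction j arbitrary: y rule: inc_induct)
  case base
  then show ?case by simp
next
  case (step j)
  have less: "y div 2 < 2 ^ (J - Suc j)" "Suc y div 2 < 2 ^ (J - Suc j)"
    using step.prems step.hyps(2)
    by (simp_all add: less_mult_imp_div_less Suc_diff_Suc flip: power_Suc2)
  note A = parent_interval[OF intervals[OF less(1)]] parent_interval[OF intervals[OF less(2)]]
  show ?case
  proof (cases "even y")
    case True
    then have "Suc y div 2 = y div 2" by presburger
    then show ?thesis using A step.hyps(2) True by force
  next
    case False
    then have eq: "Suc y div 2 = Suc (y div 2)" by presburger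
    then have "snd (the (outer (f (y div 2 * 2 ^ Suc j) (Suc j)))) =
        fst (the (outer (f (Suc y div 2 * 2 ^ Suc j) (Suc j))))"
      using step.IH[of "y div 2"] less by simp
    then show ?thesis using A step.hyps(2) False by force
  qed
qed

text \<open>Right halves inherit the right outer edge. In this way a spine node at level
  \<open>J\<close> prescribes the edge after \<open>2 ^ J\<close> columns, which fixes the input of
  the program.\<close>

lemma rightmost_leaf:
  assumes "j \<le> J"
  shows "snd (the (outer (f ((2 ^ (J - j) - 1) * 2 ^ j) j))) = snd (the (outer (f 0 J)))"
  using assms
proof (induction j rule: inc_induct)
  case base
  then show ?case by simp
next
  case (step j)
  define y where "y = (2::nat) ^ (J - j) - 1"
  have J: "J - j = Suc (J - Suc j)" using step.hyps by simp
  have y: "y div 2 = 2 ^ (J - Suc j) - 1" "odd y"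
    by (auto simp: y_def J)
  have "outer (f (y div 2 * 2 ^ Suc j) (Suc j)) \<noteq> None"
    by (rule intervals[where J = J]) (use y step.hyps in auto)
  from parent_interval[OF this] obtain m w' e' where
    "outer (f (y div 2 * 2 ^ Suc j) (Suc j)) = Some (w', e')" "outer (f (y * 2 ^ j) j) = Some (m, e')"
    using y(2) by auto
  then show ?case using step.IH by (simp only: y(1) flip: y_def) simp
qed

lemma row_matching: "east (f y 0) = west (f (Suc y) 0)"
proof -
  have out: "outer c = Some (west c, east c)" if "is_sea c" for c :: "('h, 'v) col"
    using that by (cases c) auto
  have "Suc y < 2 ^ (Suc y - 0)" using less_exp[of "Suc y"] by simp
  from adjacent_intervals[OF this] show ?thesis by (simp add: out sea_level)
qed

lemma spine_end:
  assumes "f 0 J = Up x (Some (w', m', e'))"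
  shows "east (f (2 ^ J - 1) 0) = e'"
proof -
  have out: "outer c = Some (west c, east c)" if "is_sea c" for c :: "('h, 'v) col"
    using that by (cases c) auto
  from rightmost_leaf[of 0 J] show ?thesis using assms by (simp add: out sea_level)
qed

end
end

section \<open>From tilings of the group to tiled quadrants\<close>

definition tiling :: "(bool \<Rightarrow> 'c \<Rightarrow> 'c \<Rightarrow> bool) \<Rightarrow> (nat \<Rightarrow> nat \<Rightarrow> int \<Rightarrow> 'c) \<Rightarrow> bool" where
  "tiling E \<psi> \<longleftrightarrow>
    (\<forall>\<beta> x y j. E \<beta> (\<psi> x y (int j)) (\<psi> x (fl \<beta> j y) (int j + 1))) \<and>
    (\<forall>\<beta> x y j. E \<beta> (\<psi> x y (- int j - 1)) (\<psi> (fl \<beta> j x) y (- int j)))"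

text \<open>Knowledge spreads from the seed. The row \<open>x = 0\<close> consists of tiles with
  southern boundary; hence each column consists of tiles, and all of level \<open>0\<close> does;
  then the western boundary runs along column \<open>0\<close> and gives the matching in every
  row.\<close>

lemma quadrant_of_tiling:
  fixes \<psi> :: "nat \<Rightarrow> nat \<Rightarrow> int \<Rightarrow> ('h, 'v) col"
  assumes \<psi>: "tiling rule \<psi>" and "\<psi> 0 0 0 = Sea None e0 None n0 p0 q0"
    and row: "\<forall>x y. is_sea (\<psi> x y 0) \<and> is_sea (\<psi> x (Suc y) 0) \<and>
      east (\<psi> x y 0) = west (\<psi> x (Suc y) 0) \<and>
      south (\<psi> x y 0) = None \<longrightarrow> south (\<psi> x (Suc y) 0) = None"
    and column: "\<forall>x y. is_sea (\<psi> x y 0) \<and> is_sea (\<psi> (Suc x) y 0) \<and>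
      north (\<psi> x y 0) = south (\<psi> (Suc x) y 0) \<and>
      west (\<psi> x y 0) = None \<longrightarrow> west (\<psi> (Suc x) y 0) = None"
  shows "is_sea (\<psi> x y 0)"
    and "east (\<psi> x y 0) = west (\<psi> x (Suc y) 0)"
    and "north (\<psi> x y 0) = south (\<psi> (Suc x) y 0)"
    and "west (\<psi> x 0 0) = None" and "south (\<psi> 0 y 0) = None"
    and "\<And>J b w m e. \<psi> 0 0 (int J) = Up b (Some (w, m, e)) \<Longrightarrow> east (\<psi> 0 (2 ^ J - 1) 0) = e"
proof -
  have upper: "rule \<beta> (\<psi> x y (int j)) (\<psi> x (fl \<beta> j y) (int (Suc j)))" for \<beta> x y j
    using \<psi> by (simp add: tiling_def add.commute)
  \<comment> \<open>\<open>swap\<close> turns the edges below level \<open>0\<close> around and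
    \<open>fl\<close> is its own inverse, so the lower part with \<open>y\<close> fixed satisfies
    the hypotheses of the row argument, with \<open>x\<close> as the coordinate.\<close>
  have lower: "rule \<beta> (swap (\<psi> x y (- int j))) (swap (\<psi> (fl \<beta> j x) y (- int (Suc j))))"
    for \<beta> x y j
    using \<psi> unfolding tiling_def rule_swap by (metis fl_fl minus_add_distrib of_nat_Suc uminus_add_conv_diff add.commute)
  have sea: "\<exists>e n p q. c = Sea (west c) e (south c) n p q" if "is_sea c" for c :: "('h, 'v) col"
    using that by (cases c) auto
  have swp: "is_sea (swap c) \<longleftrightarrow> is_sea c" for c :: "('h, 'v) col"
    by (cases c) auto
  have swps: "east (swap c) = north c" "west (swap c) = south c" if "is_sea c" for c :: "('h, 'v) col"
    using that by (cases c; simp)+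
  have sea0: "is_sea (\<psi> 0 y 0)" for y
    using sea_level[of "\<lambda>y j. \<psi> 0 y (int j)", OF upper] assms(2) by simp
  have match0: "east (\<psi> 0 y 0) = west (\<psi> 0 (Suc y) 0)" for y
    using row_matching[of "\<lambda>y j. \<psi> 0 y (int j)", OF upper] assms(2) by simp
  show south0: "south (\<psi> 0 y 0) = None" for y
    by (induction y) (use assms(2) row sea0 match0 in auto)
  show "east (\<psi> 0 (2 ^ J - 1) 0) = e" if "\<psi> 0 0 (int J) = Up b (Some (w, m, e))" for J b w m e
    using spine_end[of "\<lambda>y j. \<psi> 0 y (int j)", OF upper] assms(2) that by simp
  have start: "\<exists>e n p q. swap (\<psi> 0 y (- int 0)) = Sea None e (west (\<psi> 0 y 0)) n p q" for y
    using sea[OF sea0[of y]] south0[of y] by (cases "\<psi> 0 y 0") auto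
  show sea_all: "is_sea (\<psi> x y 0)" for x y
  proof -
    obtain e n p q where "swap (\<psi> 0 y (- int 0)) = Sea None e (west (\<psi> 0 y 0)) n p q"
      using start by blast
    from sea_level[of "\<lambda>x j. swap (\<psi> x y (- int j))", OF lower this, of x] show ?thesis
      by (simp add: swp)
  qed
  show col: "north (\<psi> x y 0) = south (\<psi> (Suc x) y 0)" for x y
  proof -
    obtain e n p q where "swap (\<psi> 0 y (- int 0)) = Sea None e (west (\<psi> 0 y 0)) n p q"
      using start by blast
    from row_matching[of "\<lambda>x j. swap (\<psi> x y (- int j))", OF lower this refl, of x] show ?thesis
      by (simp add: swps sea_all)
  qed
  show west0: "west (\<psi> x 0 0) = None" for x
    by (induction x) (use assms(2) column sea_all col in auto)
  show "east (\<psi> x y 0) = west (\<psi> x (Suc y) 0)"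
  proof -
    obtain e n p q where "\<psi> x 0 (int 0) = Sea None e (south (\<psi> x 0 0)) n p q"
      using sea[OF sea_all[of x 0]] west0[of x] by auto
    from row_matching[of "\<lambda>y j. \<psi> x y (int j)", OF upper this refl, of y] show ?thesis by simp
  qed
qed

section \<open>From tiled quadrants to tilings of the group\<close>

definition interval_col :: "(nat \<Rightarrow> 'h option) \<Rightarrow> nat \<Rightarrow> nat \<Rightarrow> ('h, 'v) col" where
  "interval_col h y j =
    Up (odd y) (if 2 ^ j dvd y then Some (h y, h (y + 2 ^ (j - 1)), h (y + 2 ^ j)) else None)"

definition quadrant_col ::
  "(nat \<Rightarrow> nat \<Rightarrow> 'h option) \<Rightarrow> (nat \<Rightarrow> nat \<Rightarrow> 'v option) \<Rightarrow> nat \<Rightarrow> nat \<Rightarrow> int \<Rightarrow> ('h, 'v) col" where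
  "quadrant_col h v x y n =
    (if n = 0 then Sea (h x y) (h x (Suc y)) (v x y) (v (Suc x) y) (odd y) (odd x)
     else if n > 0 then interval_col (h x) y (nat n)
     else swap (interval_col (\<lambda>i. v i y) x (nat (- n))))"

text \<open>The hypothesis on \<open>h\<close> confines the third conjunct of \<open>up_rule\<close>
  to \<open>y = 0\<close>, where every interval is stored. If the upper node stores an interval,
  then \<open>y\<close> is the start of its left or right half.\<close>

lemma rule_interval_col:
  assumes "\<And>y. h y = None \<longleftrightarrow> y = 0"
  shows "rule \<beta> (if j = 0 then Sea (h y) (h (Suc y)) s n (odd y) q else interval_col h y j)
    (interval_col h (fl \<beta> j y) (Suc j))"
proof -
  let ?z = "fl \<beta> j y"
  have odd: "odd ?z = (odd y \<noteq> (j = 0 \<and> \<beta>))" by (rule odd_fl)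
  have y: "2 ^ j dvd y" "y = (if \<beta> then ?z + 2 ^ j else ?z)" if "2 ^ Suc j dvd ?z"
  proof -
    have z: "\<not> bit ?z i" if "i < Suc j" for i
      using \<open>2 ^ Suc j dvd ?z\<close> that by (auto simp only: dvd_power2_iff)
    show "2 ^ j dvd y" using z bit_fl[of \<beta> j y] by (auto simp only: dvd_power2_iff less_Suc_eq)
    have "y = fl \<beta> j ?z" by simp
    also have "\<dots> = (if \<beta> then ?z + 2 ^ j else ?z)" using fl_unset[OF z[of j]] by (auto simp only: fl_def lessI if_True if_False)
    finally show "y = (if \<beta> then ?z + 2 ^ j else ?z)" .
  qed
  have outer: "outer (if j = 0 then Sea (h y) (h (Suc y)) s n (odd y) q else interval_col h y j) =
      Some (h y, h (y + 2 ^ j))" if "2 ^ j dvd y"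
    using that by (simp add: interval_col_def)
  have outer': "y = 0" if "outer (if j = 0 then Sea (h y) (h (Suc y)) s n (odd y) q
      else interval_col h y j) = Some (None, e)" for e
    using that assms by (auto simp: interval_col_def split: if_splits)
  show ?thesis
    unfolding rule_Up_iff interval_col_def[of h ?z] up_rule.simps
  proof (intro conjI impI allI)
    show "label \<beta> (if j = 0 then Sea (h y) (h (Suc y)) s n (odd y) q else interval_col h y j) = Some (odd ?z)"
      using odd by (auto simp: interval_col_def)
    fix w m e
    assume I: "(if 2 ^ Suc j dvd ?z then Some (h ?z, h (?z + 2 ^ (Suc j - 1)), h (?z + 2 ^ Suc j)) else None) = Some (w, m, e)"
    then have "2 ^ Suc j dvd ?z" by (auto split: if_splits)
    note y = y[OF this]
    show "outer (if j = 0 then Sea (h y) (h (Suc y)) s n (odd y) q else interval_col h y j) =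
      Some (if \<beta> then (m, e) else (w, m))"
      unfolding outer[OF y(1)] using I y(2) by (auto split: if_splits simp: mult_2 add.assoc)
  next
    assume "\<not> \<beta> \<and> (\<exists>e. outer (if j = 0 then Sea (h y) (h (Suc y)) s n (odd y) q else interval_col h y j) = Some (None, e))"
    then have "?z = 0" using outer' by auto
    then show "(if 2 ^ Suc j dvd ?z then Some (h ?z, h (?z + 2 ^ (Suc j - 1)), h (?z + 2 ^ Suc j)) else None) \<noteq> None"
      by simp
  qed
qed

lemma tiling_of_quadrant:
  assumes "\<And>x y. h x y = None \<longleftrightarrow> y = 0" "\<And>x y. v x y = None \<longleftrightarrow> x = 0"
  shows "tiling rule (quadrant_col h v)"
  unfolding tiling_def
proof (intro conjI allI)
  fix \<beta> x y j
  have q: "quadrant_col h v x y (int j) = (if j = 0 then Sea (h x y) (h x (Suc y)) (v x y) (v (Suc x) y) (odd y) (odd x)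
      else interval_col (h x) y j)" for x y j
    by (simp add: quadrant_col_def)
  have "int j + 1 = int (Suc j)" by simp
  then show "rule \<beta> (quadrant_col h v x y (int j)) (quadrant_col h v x (fl \<beta> j y) (int j + 1))"
    using rule_interval_col[of "h x" \<beta> j y "v x y" "v (Suc x) y" "odd x"] assms(1) by (simp only: q) simp
  have q': "quadrant_col h v x y (- int j) = swap (if j = 0 then Sea (v x y) (v (Suc x) y) (h x y) (h x (Suc y)) (odd x) (odd y)
      else interval_col (\<lambda>i. v i y) x j)" for x y j
    by (simp add: quadrant_col_def)
  have "- int j - 1 = - int (Suc j)" by simp
  then show "rule \<beta> (quadrant_col h v x y (- int j - 1)) (quadrant_col h v (fl \<beta> j x) y (- int j))"
    using rule_interval_col[of "\<lambda>i. v i y" \<beta> j "fl \<beta> j x" "h (fl \<beta> j x) y" "h (fl \<beta> j x) (Suc y)"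
      "odd y"] assms(2)
    by (simp only: q' rule_swap) simp
qed

subsection \<open>Coordinates on the lamplighter group\<close>

text \<open>Natural numbers encode, by their bits, the finite sets of lit lamps on either side of
  the origin.\<close>

definition cfg :: "nat \<Rightarrow> nat \<Rightarrow> int \<Rightarrow> bit" where
  "cfg x y i = of_bool (if i \<ge> 0 then bit y (nat i) else bit x (nat (- 1 - i)))"

lemma cfg_nonneg [simp]: "cfg x y (int i) = of_bool (bit y i)"
  by (simp add: cfg_def)

lemma cfg_neg [simp]: "cfg x y (- int i - 1) = of_bool (bit x i)"
  by (simp add: cfg_def)

lemma cfg_0 [simp]: "cfg 0 0 = (\<lambda>i. 0)"
  by (auto simp: cfg_def)

lemma cfg_inject [simp]: "cfg x y = cfg x' y' \<longleftrightarrow> x = x' \<and> y = y'"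
proof
  assume eq: "cfg x y = cfg x' y'"
  have "bit x i = bit x' i" for i using fun_cong[OF eq, of "- int i - 1"] by (simp add: of_bool_eq_iff)
  moreover have "bit y i = bit y' i" for i using fun_cong[OF eq, of "int i"] by (simp add: of_bool_eq_iff)
  ultimately show "x = x' \<and> y = y'" by (auto intro: bit_eqI)
qed simp

lemma finite_bits: "finite {i. bit (y::nat) i}"
proof (rule finite_subset)
  show "{i. bit y i} \<subseteq> {..<y}"
    using less_power2_iff[of y y] less_exp[of y] by (metis lessThan_iff linorder_not_le mem_Collect_eq subsetI)
qed simp

lemma bit_set_encode: "finite A \<Longrightarrow> bit (set_encode A) i \<longleftrightarrow> i \<in> A"
  using set_encode_inverse[of A] by (auto simp: set_decode_def bit_iff_odd)

lemma finite_cfg: "finite {i. cfg x y i \<noteq> 0}"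
proof (rule finite_subset)
  show "{i. cfg x y i \<noteq> 0} \<subseteq> int ` {i. bit y i} \<union> (\<lambda>i. - int i - 1) ` {i. bit x i}"
  proof
    fix i
    assume "i \<in> {i. cfg x y i \<noteq> 0}"
    then show "i \<in> int ` {i. bit y i} \<union> (\<lambda>i. - int i - 1) ` {i. bit x i}"
      by (cases "i \<ge> 0")
        (force simp: cfg_def intro: image_eqI[of _ _ "nat i"] image_eqI[of _ _ "nat (- 1 - i)"])+
  qed
qed (use finite_bits in blast)

lemma cfg_surj:
  assumes "finite {i. s i \<noteq> 0}"
  obtains x y where "s = cfg x y"
proof -
  define X where "X = {i. s (- int i - 1) \<noteq> 0}"
  define Y where "Y = {i. s (int i) \<noteq> 0}"
  have fin: "finite X" "finite Y"
    unfolding X_def Y_def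
    using finite_vimageI[OF assms, of "\<lambda>i. - int i - 1"] finite_vimageI[OF assms, of int]
    by (simp_all add: vimage_def inj_on_def)
  have "s = cfg (set_encode X) (set_encode Y)"
  proof
    fix i
    have "bit (set_encode Y) (nat i) \<longleftrightarrow> s i \<noteq> 0" if "i \<ge> 0"
      using that by (simp only: bit_set_encode[OF fin(2)]) (simp add: Y_def)
    moreover have "bit (set_encode X) (nat (- 1 - i)) \<longleftrightarrow> s i \<noteq> 0" if "\<not> i \<ge> 0"
      using that by (simp only: bit_set_encode[OF fin(1)]) (simp add: X_def)
    ultimately show "s i = cfg (set_encode X) (set_encode Y) i"
      by (cases "i \<ge> 0"; cases "s i = 0") (simp_all add: cfg_def)
  qed
  then show ?thesis by (rule that)
qed

lemma carrier_lamplighter: "carrier lamplighter = {(cfg x y, n) | x y n. True}"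
proof -
  have "finite {i. s i \<noteq> 0} \<longleftrightarrow> (\<exists>x y. s = cfg x y)" for s
    using finite_cfg cfg_surj[of s] by blast
  then show ?thesis by (auto simp: lamplighter_def simp del: bit_not_zero_iff)
qed

definition up_gen :: "bool \<Rightarrow> lamp" where
  "up_gen \<beta> = (if \<beta> then lamp_b else lamp_a)"

lemma up_gen_eq: "up_gen \<beta> = (\<lambda>i. of_bool (\<beta> \<and> i = 0), 1)"
  by (auto simp: up_gen_def lamp_a_def lamp_b_def fun_eq_iff)

lemma up_gen_carrier: "up_gen \<beta> \<in> carrier lamplighter"
  using lamp_gens_subset by (auto simp: up_gen_def lamp_gens_def)

text \<open>Right multiplication by \<open>b\<close> flips the lamp at the current position, which
  is bit \<open>j\<close> of \<open>y\<close> at height \<open>int j\<close> and bit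
  \<open>j\<close> of \<open>x\<close> at height \<open>- int j - 1\<close>.\<close>

lemma mult_up_gen:
  "(cfg x y, int j) \<otimes>\<^bsub>lamplighter\<^esub> up_gen \<beta> = (cfg x (fl \<beta> j y), int j + 1)"
  "(cfg x y, - int j - 1) \<otimes>\<^bsub>lamplighter\<^esub> up_gen \<beta> = (cfg (fl \<beta> j x) y, - int j)"
proof -
  have *: "nat i = j \<longleftrightarrow> i = int j" if "i \<ge> 0" for i using that by auto
  have **: "nat (- 1 - i) = j \<longleftrightarrow> i = - int j - 1" if "\<not> i \<ge> 0" for i using that by auto
  show "(cfg x y, int j) \<otimes>\<^bsub>lamplighter\<^esub> up_gen \<beta> = (cfg x (fl \<beta> j y), int j + 1)"
    by (auto simp: lamplighter_def up_gen_eq fun_eq_iff cfg_def bit_fl *)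
  show "(cfg x y, - int j - 1) \<otimes>\<^bsub>lamplighter\<^esub> up_gen \<beta> = (cfg (fl \<beta> j x) y, - int j)"
    by (auto simp: lamplighter_def up_gen_eq fun_eq_iff cfg_def bit_fl **)
qed

lemma nonneg_or_neg_int: obtains j where "n = int j" | j where "n = - int j - 1"
proof (cases "n \<ge> 0")
  case True
  then show ?thesis using that(1)[of "nat n"] by simp
next
  case False
  then show ?thesis using that(2)[of "nat (- n - 1)"] by simp
qed

text \<open>Every constraint along a generator is repeated, reversed, for its inverse, so a
  colouring is determined to be valid by its edges along \<open>a\<close> and
  \<open>b\<close>.\<close>

definition edges_of :: "(bool \<Rightarrow> 'c \<Rightarrow> 'c \<Rightarrow> bool) \<Rightarrow> ('c \<times> lamp \<times> 'c) set" where
  "edges_of E = (\<Union>\<beta>. {(u, up_gen \<beta>, v) | u v. E \<beta> u v} \<union>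
    {(v, inv\<^bsub>lamplighter\<^esub> up_gen \<beta>, u) | u v. E \<beta> u v})"

lemma gens_distinct:
  "up_gen \<beta> = up_gen \<gamma> \<longleftrightarrow> \<beta> = \<gamma>"
  "inv\<^bsub>lamplighter\<^esub> up_gen \<beta> = inv\<^bsub>lamplighter\<^esub> up_gen \<gamma> \<longleftrightarrow> \<beta> = \<gamma>"
  "up_gen \<beta> \<noteq> inv\<^bsub>lamplighter\<^esub> up_gen \<gamma>"
  "inv\<^bsub>lamplighter\<^esub> up_gen \<gamma> \<noteq> up_gen \<beta>"
proof -
  interpret group lamplighter by (rule group_lamplighter)
  show eq: "up_gen \<beta> = up_gen \<gamma> \<longleftrightarrow> \<beta> = \<gamma>" for \<beta> \<gamma>
    by (auto simp: up_gen_eq fun_eq_iff dest: spec[of _ "0::int"])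
  show "inv\<^bsub>lamplighter\<^esub> up_gen \<beta> = inv\<^bsub>lamplighter\<^esub> up_gen \<gamma> \<longleftrightarrow> \<beta> = \<gamma>"
    using eq up_gen_carrier by (metis inv_inv)
  have "up_gen \<beta> \<otimes>\<^bsub>lamplighter\<^esub> up_gen \<gamma> \<noteq> \<one>\<^bsub>lamplighter\<^esub>"
    by (simp add: up_gen_eq lamplighter_def)
  then show "up_gen \<beta> \<noteq> inv\<^bsub>lamplighter\<^esub> up_gen \<gamma>"
    using l_inv up_gen_carrier by metis
  then show "inv\<^bsub>lamplighter\<^esub> up_gen \<gamma> \<noteq> up_gen \<beta>" by metis
qed

lemma mem_edges_of [simp]:
  "(u, up_gen \<beta>, v) \<in> edges_of E \<longleftrightarrow> E \<beta> u v"
  "(v, inv\<^bsub>lamplighter\<^esub> up_gen \<beta>, u) \<in> edges_of E \<longleftrightarrow> E \<beta> u v"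
  by (auto simp: edges_of_def gens_distinct)

lemma lamp_gens_eq: "lamp_gens = range up_gen \<union> range (\<lambda>\<beta>. inv\<^bsub>lamplighter\<^esub> up_gen \<beta>)"
  by (auto simp: lamp_gens_def up_gen_def UNIV_bool)

lemma seeded_tileable_edges_of:
  "seeded_tileable lamplighter lamp_gens A (edges_of E) a0 \<longleftrightarrow>
    (\<exists>\<psi>. tiling E \<psi> \<and> \<psi> 0 0 0 = a0 \<and> (\<forall>x y n. \<psi> x y n \<in> A))"
    (is "?L \<longleftrightarrow> ?R")
proof -
  interpret group lamplighter by (rule group_lamplighter)
  have one: "\<one>\<^bsub>lamplighter\<^esub> = (cfg 0 0, 0)" by (simp add: lamplighter_def)
  have mem: "(cfg x y, n) \<in> carrier lamplighter" for x y n by (auto simp: carrier_lamplighter)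
  show ?thesis
  proof
    assume ?L
    then obtain \<phi> where A: "\<phi> \<in> carrier lamplighter \<rightarrow> A" and seed: "\<phi> \<one>\<^bsub>lamplighter\<^esub> = a0"
      and E: "\<forall>g\<in>carrier lamplighter. \<forall>s\<in>lamp_gens. (\<phi> g, s, \<phi> (g \<otimes>\<^bsub>lamplighter\<^esub> s)) \<in> edges_of E"
      unfolding seeded_tileable_def by blast
    have up: "E \<beta> (\<phi> g) (\<phi> (g \<otimes>\<^bsub>lamplighter\<^esub> up_gen \<beta>))" if "g \<in> carrier lamplighter" for g \<beta>
      using E[rule_format, OF that, of "up_gen \<beta>"] by (simp add: lamp_gens_eq)
    have "tiling E (\<lambda>x y n. \<phi> (cfg x y, n))"
      unfolding tiling_def using up[OF mem] by (metis mult_up_gen)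
    then show ?R
      using A seed mem by (intro exI[of _ "\<lambda>x y n. \<phi> (cfg x y, n)"]) (auto simp: one)
  next
    assume ?R
    then obtain \<psi> where t: "tiling E \<psi>" and seed: "\<psi> 0 0 0 = a0" and A: "\<And>x y n. \<psi> x y n \<in> A"
      by blast
    \<comment> \<open>Coordinates are unique by \<open>cfg_inject\<close>, so the description
      denotes a single value on the carrier.\<close>
    define \<phi> where "\<phi> g = (THE c. \<exists>x y. fst g = cfg x y \<and> c = \<psi> x y (snd g))" for g :: lamp
    have \<phi>: "\<phi> (cfg x y, n) = \<psi> x y n" for x y n
      unfolding \<phi>_def by (rule the_equality) auto
    have up: "E \<beta> (\<phi> g) (\<phi> (g \<otimes>\<^bsub>lamplighter\<^esub> up_gen \<beta>))" if g: "g \<in> carrier lamplighter" for g \<beta>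
    proof -
      from g obtain x y n where "g = (cfg x y, n)" by (auto simp: carrier_lamplighter)
      then show ?thesis
        using t by (cases n rule: nonneg_or_neg_int) (simp_all add: mult_up_gen \<phi> tiling_def)
    qed
    have "(\<phi> g, s, \<phi> (g \<otimes>\<^bsub>lamplighter\<^esub> s)) \<in> edges_of E"
      if g: "g \<in> carrier lamplighter" and s: "s \<in> lamp_gens" for g s
    proof -
      from s consider \<beta> where "s = up_gen \<beta>" | \<beta> where "s = inv\<^bsub>lamplighter\<^esub> up_gen \<beta>"
        by (auto simp: lamp_gens_eq)
      then show ?thesis
      proof cases
        case 1
        then show ?thesis using up[OF g] by simp
      next
        case 2
        then have "g \<otimes>\<^bsub>lamplighter\<^esub> s \<in> carrier lamplighter"
          and "g \<otimes>\<^bsub>lamplighter\<^esub> s \<otimes>\<^bsub>lamplighter\<^esub> up_gen \<beta> = g"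
          using g up_gen_carrier[of \<beta>] by (simp_all add: m_assoc)
        then show ?thesis using up[of "g \<otimes>\<^bsub>lamplighter\<^esub> s" \<beta>] 2 by simp
      qed
    qed
    moreover have "\<phi> \<in> carrier lamplighter \<rightarrow> A"
      using A \<phi> by (auto simp: carrier_lamplighter)
    ultimately show ?L
      unfolding seeded_tileable_def using seed by (intro bexI[of _ \<phi>]) (auto simp: one \<phi> simp del: cfg_0)
  qed
qed

subsection \<open>Wang tiles simulating a register program\<close>

fun regs_below :: "nat \<Rightarrow> com \<Rightarrow> bool" where
  "regs_below K Skip \<longleftrightarrow> True"
| "regs_below K (Asg d s m) \<longleftrightarrow> d < K \<and> s < K"
| "regs_below K (Seq c1 c2) \<longleftrightarrow> regs_below K c1 \<and> regs_below K c2"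
| "regs_below K (While r c) \<longleftrightarrow> r < K \<and> regs_below K c"

lemma regs_below_mono: "regs_below K c \<Longrightarrow> K \<le> K' \<Longrightarrow> regs_below K' c"
  by (induction c) auto

lemma ex_regs_below: "\<exists>K>0. regs_below K c"
proof (induction c)
  case Skip
  then show ?case by auto
next
  case (Asg d s m)
  then show ?case by (intro exI[of _ "Suc (max d s)"]) auto
next
  case (Seq c1 c2)
  then obtain K1 K2 where "K1 > 0" "regs_below K1 c1" "regs_below K2 c2" by blast
  then show ?case by (intro exI[of _ "max K1 K2"]) (auto intro: regs_below_mono)
next
  case (While r c)
  then obtain K where "K > 0" "regs_below K c" by blast
  then show ?case by (intro exI[of _ "max K (Suc r)"]) (auto intro: regs_below_mono)
qed

text \<open>A finite set containing \<open>c\<close> and closed under \<open>next_com\<close>, which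
  keeps the tile set finite. Only the first component of a \<open>Seq\<close> evolves.\<close>

fun states :: "com \<Rightarrow> com set" where
  "states Skip = {Skip}"
| "states (Asg d s m) = {Asg d s m, Skip}"
| "states (Seq c1 c2) = (\<lambda>x. Seq x c2) ` states c1 \<union> states c2"
| "states (While r c) = {While r c, Skip} \<union> (\<lambda>x. Seq x (While r c)) ` states c"

lemma finite_states: "finite (states c)"
  by (induction c) auto

lemma states_self: "c \<in> states c"
  by (induction c) auto

lemma states_next: "x \<in> states c \<Longrightarrow> next_com x b \<in> states c"
proof (induction c arbitrary: x)
  case (Seq c1 c2)
  from Seq.prems consider y where "x = Seq y c2" "y \<in> states c1" | "x \<in> states c2"
    by auto
  then show ?case
  proof cases
    case 1
    then show ?thesis using Seq.IH(1)[of y] states_self[of c2] by simp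
  next
    case 2
    then show ?thesis using Seq.IH(2)[of x] by simp
  qed
next
  case (While r c)
  from While.prems consider "x = While r c" | "x = Skip"
    | y where "x = Seq y (While r c)" "y \<in> states c"
    by auto
  then show ?case
  proof cases
    case 3
    then show ?thesis using While.IH[of y] by simp
  qed (use states_self[of c] in simp_all)
qed auto

lemma regs_below_states: "regs_below K c \<Longrightarrow> x \<in> states c \<Longrightarrow> regs_below K x"
proof (induction c arbitrary: x)
  case (Seq c1 c2)
  from Seq.prems(2) consider y where "x = Seq y c2" "y \<in> states c1" | "x \<in> states c2"
    by auto
  then show ?case
  proof cases
    case 1
    then show ?thesis using Seq.IH(1)[of y] Seq.prems(1) by simp
  next
    case 2
    then show ?thesis using Seq.IH(2)[of x] Seq.prems(1) by simp
  qed
next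
  case (While r c)
  from While.prems(2) consider "x = While r c" | "x = Skip"
    | y where "x = Seq y (While r c)" "y \<in> states c"
    by auto
  then show ?case
  proof cases
    case 3
    then show ?thesis using While.IH[of y] While.prems(1) by simp
  qed (use While.prems(1) in simp_all)
qed auto

lemma test_less: "regs_below K c \<Longrightarrow> K > 0 \<Longrightarrow> test c < K"
  by (induction c) auto

lemma next_op_less:
  assumes "regs_below K c" "K > 0"
  shows "fst (next_op c b) < K \<and> fst (snd (next_op c b)) < K"
  using assms by (induction c) simp_all

text \<open>Row \<open>x\<close> of a tiling holds the configuration at time \<open>x\<close>, and the cell in column \<open>y\<close> holds
  the set \<open>B\<close> of the registers with content greater than \<open>y\<close>. The flags \<open>z\<close> and \<open>f\<close> mark the
  first row and the first column, \<open>b\<close> is the outcome of the test of the current command, and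
  \<open>Bl\<close>, \<open>Br\<close> are the sets of the two horizontal neighbours.\<close>

type_synonym hedge = "bool \<times> bool \<times> nat set \<times> nat set"
type_synonym vedge = "bool \<times> com \<times> nat set"
type_synonym wang_tile = "hedge option \<times> hedge option \<times> vedge option \<times> vedge option"

text \<open>Cell \<open>y\<close> records whether \<open>y < v\<close>. Now \<open>y < v + 1\<close>
  iff \<open>y = 0\<close> or \<open>y - 1 < v\<close>, and \<open>y < v - 1\<close> iff
  \<open>y + 1 < v\<close>; so an increment reads the left neighbour and a decrement the right
  one.\<close>

definition next_cell :: "nat \<Rightarrow> bool \<Rightarrow> nat \<times> nat \<times> mode \<Rightarrow> nat set \<Rightarrow> nat set \<Rightarrow> nat set \<Rightarrow> nat set" where
  "next_cell K f = (\<lambda>(d, s, m) Bl B Br. {r. r < K \<and> (if r = d then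
      (case m of Clr \<Rightarrow> False | Cpy \<Rightarrow> s \<in> B | Inc \<Rightarrow> f \<or> s \<in> Bl | Dec \<Rightarrow> s \<in> Br) else r \<in> B)})"

text \<open>Adjacent tiles share two of the three sets, so matching turns the guesses
  \<open>Bl\<close> and \<open>Br\<close> into the true neighbouring sets. Every column keeps its
  own copy of the command; the copies agree because \<open>b\<close> is passed along the
  row.\<close>

definition tile :: "nat \<Rightarrow> bool \<Rightarrow> bool \<Rightarrow> com \<Rightarrow> bool \<Rightarrow> nat set \<Rightarrow> nat set \<Rightarrow> nat set \<Rightarrow> wang_tile" where
  "tile K z f q b Bl B Br =
    (if f then None else Some (z, b, Bl, B), Some (z, b, B, Br),
     if z then None else Some (f, q, B),
     Some (f, next_com q b, next_cell K f (next_op q b) Bl B Br))"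

text \<open>No tile carries \<open>Skip\<close>, so a halting run cannot be tiled. The first column
  evaluates the test, since there membership means a positive register. The first row holds in
  register \<open>0\<close> a positive, possibly infinite input; the spine will fix its
  size.\<close>

definition wang :: "com \<Rightarrow> nat \<Rightarrow> wang_tile set" where
  "wang c K = {tile K z f q b Bl B Br | z f q b Bl B Br.
    Bl \<subseteq> {..<K} \<and> B \<subseteq> {..<K} \<and> Br \<subseteq> {..<K} \<and> q \<in> states c \<and> q \<noteq> Skip \<and>
    (f \<longrightarrow> b = (test q \<in> B)) \<and> (z \<longrightarrow> q = c \<and> B \<subseteq> {0} \<and> Br \<subseteq> B \<and> (f \<longrightarrow> 0 \<in> B))}"

lemma finite_wang: "finite (wang c K)"
proof (rule finite_subset)
  show "wang c K \<subseteq> (\<lambda>(z, f, q, b, Bl, B, Br). tile K z f q b Bl B Br) `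
      (UNIV \<times> UNIV \<times> states c \<times> UNIV \<times> Pow {..<K} \<times> Pow {..<K} \<times> Pow {..<K})"
  proof
    fix T
    assume "T \<in> wang c K"
    then obtain z f q b Bl B Br where "T = tile K z f q b Bl B Br" "q \<in> states c"
      "Bl \<subseteq> {..<K}" "B \<subseteq> {..<K}" "Br \<subseteq> {..<K}"
      unfolding wang_def by blast
    then show "T \<in> (\<lambda>(z, f, q, b, Bl, B, Br). tile K z f q b Bl B Br) `
      (UNIV \<times> UNIV \<times> states c \<times> UNIV \<times> Pow {..<K} \<times> Pow {..<K} \<times> Pow {..<K})"
      by (intro image_eqI[of _ _ "(z, f, q, b, Bl, B, Br)"]) simp_all
  qed
qed (simp add: finite_states)

lemma tile_wangI:
  assumes "Bl \<subseteq> {..<K}" "B \<subseteq> {..<K}" "Br \<subseteq> {..<K}" "q \<in> states c" "q \<noteq> Skip"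
    "f \<Longrightarrow> b = (test q \<in> B)" "z \<Longrightarrow> q = c \<and> B \<subseteq> {0} \<and> Br \<subseteq> B \<and> (f \<longrightarrow> 0 \<in> B)"
  shows "tile K z f q b Bl B Br \<in> wang c K"
  unfolding wang_def using assms by blast

lemma wang_boundary:
  assumes "(w, e, s, n) \<in> wang c K" "(w', e', s', n') \<in> wang c K"
  shows "e = w' \<Longrightarrow> s = None \<Longrightarrow> s' = None" "n = s' \<Longrightarrow> w = None \<Longrightarrow> w' = None"
  using assms by (auto simp: wang_def tile_def split: if_splits)

section \<open>Rows of the quadrant as configurations of a run\<close>

definition run :: "com \<Rightarrow> nat \<Rightarrow> nat \<Rightarrow> com \<times> (nat \<Rightarrow> nat)" where
  "run c i t = (step ^^ t) (c, (\<lambda>_. 0)(0 := i))"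

lemma run_0: "run c i 0 = (c, (\<lambda>_. 0)(0 := i))"
  by (simp add: run_def)

lemma run_Suc: "run c i (Suc t) = (let q = fst (run c i t); \<sigma> = snd (run c i t); b = \<sigma> (test q) > 0
    in (next_com q b, apply_op (next_op q b) \<sigma>))"
  by (simp add: run_def step_def Let_def split: prod.split)

lemma run_states: "fst (run c i t) \<in> states c"
  by (induction t) (auto simp: run_0 run_Suc Let_def states_self states_next)

definition cell :: "com \<Rightarrow> nat \<Rightarrow> nat \<Rightarrow> nat \<Rightarrow> nat \<Rightarrow> nat set" where
  "cell c K i t y = {r. r < K \<and> y < snd (run c i t) r}"

definition test_result :: "com \<Rightarrow> nat \<Rightarrow> nat \<Rightarrow> bool" where
  "test_result c i t \<longleftrightarrow> snd (run c i t) (test (fst (run c i t))) > 0"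

text \<open>At \<open>y = 0\<close> the set \<open>Bl\<close> is arbitrary: the flag already decides
  the increment.\<close>

lemma cell_Suc:
  assumes "regs_below K c" "K > 0"
  shows "cell c K i (Suc t) y =
    next_cell K (y = 0) (next_op (fst (run c i t)) (test_result c i t))
      (if y = 0 then Bl else cell c K i t (y - 1)) (cell c K i t y) (cell c K i t (Suc y))"
proof -
  obtain d s m where op: "next_op (fst (run c i t)) (test_result c i t) = (d, s, m)"
    by (metis surj_pair)
  have "d < K" "s < K"
    using next_op_less[OF regs_below_states[OF assms(1) run_states] assms(2)] op by (metis fst_conv snd_conv)+
  moreover have "snd (run c i (Suc t)) = (snd (run c i t))(d := upd m (snd (run c i t) s))"
    using op by (simp add: run_Suc Let_def test_result_def apply_op_def)
  ultimately show ?thesis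
    unfolding op by (cases m) (auto simp: cell_def next_cell_def)
qed

lemma test_result_cell:
  assumes "regs_below K c" "K > 0"
  shows "test_result c i t \<longleftrightarrow> test (fst (run c i t)) \<in> cell c K i t 0"
  using test_less[OF regs_below_states[OF assms(1) run_states] assms(2)]
  by (auto simp: test_result_def cell_def)

lemma cell_0: "K > 0 \<Longrightarrow> cell c K i 0 y = (if y < i then {0} else {})"
  by (auto simp: cell_def run_0)

definition run_h :: "com \<Rightarrow> nat \<Rightarrow> nat \<Rightarrow> nat \<Rightarrow> nat \<Rightarrow> hedge option" where
  "run_h c K i t y = (if y = 0 then None
    else Some (t = 0, test_result c i t, cell c K i t (y - 1), cell c K i t y))"

definition run_v :: "com \<Rightarrow> nat \<Rightarrow> nat \<Rightarrow> nat \<Rightarrow> nat \<Rightarrow> vedge option" where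
  "run_v c K i t y = (if t = 0 then None else Some (y = 0, fst (run c i t), cell c K i t y))"

lemma run_wang:
  assumes c: "regs_below K c" "K > 0" and "i > 0" and run: "fst (run c i t) \<noteq> Skip"
  shows "(run_h c K i t y, run_h c K i t (Suc y), run_v c K i t y, run_v c K i (Suc t) y) \<in> wang c K"
proof -
  let ?Bl = "if y = 0 then {} else cell c K i t (y - 1)"
  let ?q = "fst (run c i t)" and ?b = "test_result c i t"
  have "(run_h c K i t y, run_h c K i t (Suc y), run_v c K i t y, run_v c K i (Suc t) y) =
      tile K (t = 0) (y = 0) ?q ?b ?Bl (cell c K i t y) (cell c K i t (Suc y))"
    unfolding tile_def cell_Suc[OF c, where Bl = "{}", symmetric]
    by (simp add: run_h_def run_v_def run_Suc Let_def test_result_def)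
  moreover have cells: "cell c K i t y' \<subseteq> {..<K}" for y' by (auto simp: cell_def)
  have "tile K (t = 0) (y = 0) ?q ?b ?Bl (cell c K i t y) (cell c K i t (Suc y)) \<in> wang c K"
  proof (rule tile_wangI)
    show "?Bl \<subseteq> {..<K}" using cells by simp
    show "?b = (test ?q \<in> cell c K i t y)" if "y = 0"
      using test_result_cell[OF c] that by simp
    show "?q = c \<and> cell c K i t y \<subseteq> {0} \<and> cell c K i t (Suc y) \<subseteq> cell c K i t y \<and>
        (y = 0 \<longrightarrow> 0 \<in> cell c K i t y)" if "t = 0"
      using that \<open>i > 0\<close> by (simp add: run_0 cell_0[OF c(2)])
  qed (use cells run run_states in simp_all)
  ultimately show ?thesis by simp
qed

lemma wang_run:
  fixes w e :: "nat \<Rightarrow> nat \<Rightarrow> hedge option" and s n :: "nat \<Rightarrow> nat \<Rightarrow> vedge option"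
  assumes c: "regs_below K c" "K > 0" and "i > 0"
    and wang: "\<And>x y. (w x y, e x y, s x y, n x y) \<in> wang c K"
    and match: "\<And>x y. e x y = w x (Suc y)" "\<And>x y. n x y = s (Suc x) y"
    and boundary: "\<And>x. w x 0 = None" "\<And>y. s 0 y = None"
    and input: "e 0 (i - 1) = Some (z0, b0, {0}, {})"
  shows "fst (run c i t) \<noteq> Skip"
proof -
  have "\<exists>z f q b Bl B Br. (w x y, e x y, s x y, n x y) = tile K z f q b Bl B Br \<and>
      q \<in> states c \<and> q \<noteq> Skip \<and>
      (f \<longrightarrow> b = (test q \<in> B)) \<and> (z \<longrightarrow> q = c \<and> B \<subseteq> {0} \<and> Br \<subseteq> B \<and> (f \<longrightarrow> 0 \<in> B))" for x y
    using wang[of x y] unfolding wang_def by blast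
  then obtain z f q b Bl B Br where T:
    "\<And>x y. (w x y, e x y, s x y, n x y) =
      tile K (z x y) (f x y) (q x y) (b x y) (Bl x y) (B x y) (Br x y)"
    and q: "\<And>x y. q x y \<noteq> Skip"
    and test: "\<And>x y. f x y \<longrightarrow> b x y = (test (q x y) \<in> B x y)"
    and first: "\<And>x y. z x y \<longrightarrow> q x y = c \<and> B x y \<subseteq> {0} \<and> Br x y \<subseteq> B x y \<and> (f x y \<longrightarrow> 0 \<in> B x y)"
    by metis
  have w: "w x y = (if f x y then None else Some (z x y, b x y, Bl x y, B x y))"
    and e: "e x y = Some (z x y, b x y, B x y, Br x y)"
    and s: "s x y = (if z x y then None else Some (f x y, q x y, B x y))"
    and n: "n x y = Some (f x y, next_com (q x y) (b x y),
        next_cell K (f x y) (next_op (q x y) (b x y)) (Bl x y) (B x y) (Br x y))" for x y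
    using T[of x y] unfolding tile_def by simp_all
  have f: "f x y \<longleftrightarrow> y = 0" for x y
    using w[of x y] boundary(1)[of x] match(1)[of x "y - 1"] e[of x "y - 1"]
    by (cases y) (auto split: if_splits)
  have z: "z x y \<longleftrightarrow> x = 0" for x y
    using s[of x y] boundary(2)[of y] match(2)[of "x - 1" y] n[of "x - 1" y]
    by (cases x) (auto split: if_splits)
  have h: "b x (Suc y) = b x y" "Bl x (Suc y) = B x y" "B x (Suc y) = Br x y" for x y
    using match(1)[of x y] w[of x "Suc y"] e[of x y] f by auto
  have v: "q (Suc x) y = next_com (q x y) (b x y)"
    "B (Suc x) y = next_cell K (y = 0) (next_op (q x y) (b x y)) (Bl x y) (B x y) (Br x y)" for x y
    using match(2)[of x y] s[of "Suc x" y] n[of x y] f z by auto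
  \<comment> \<open>Only the first column checks \<open>b\<close>; the shared edges carry it to the
    others.\<close>
  have b: "b x y = (test (q x 0) \<in> B x 0)" for x y
    by (induction y) (use test f h in auto)
  have Bl: "Bl x y = (if y = 0 then Bl x 0 else B x (y - 1))" for x y
    using h(2)[of x "y - 1"] by (cases y) auto
  have inv: "q t y = fst (run c i t) \<and> B t y = cell c K i t y" for t y
  proof (induction t arbitrary: y)
    case 0
    \<comment> \<open>The first row is decreasing, so the prescribed drop between columns
      \<open>i - 1\<close> and \<open>i\<close> determines it.\<close>
    have anti: "B 0 y' \<subseteq> B 0 y" if "y \<le> y'" for y y'
    proof (rule lift_Suc_antimono_le[OF _ that])
      show "B 0 (Suc y) \<subseteq> B 0 y" for y using first[of 0 y] z[of 0 y] h(3)[of 0 y] by simp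
    qed
    have "B 0 (i - 1) = {0}" "B 0 i = {}"
      using input e[of 0 "i - 1"] h(3)[of 0 "i - 1"] \<open>i > 0\<close> by auto
    then have "B 0 y = (if y < i then {0} else {})"
      using anti[of y "i - 1"] anti[of i y] first[of 0 y] z by auto
    then show ?case using first[of 0 y] z c(2) by (simp add: cell_0 run_0)
  next
    case (Suc t)
    have b': "b t y = test_result c i t" for y
      using b[of t y] Suc test_result_cell[OF c] by simp
    have "B (Suc t) y = cell c K i (Suc t) y"
      unfolding v(2) cell_Suc[OF c, where Bl = "Bl t 0"] using Suc Bl[of t y] b' h(3)[of t y]
      by simp
    moreover have "q (Suc t) y = fst (run c i (Suc t))"
      using Suc b' by (simp add: v(1) run_Suc Let_def test_result_def)
    ultimately show ?case by blast
  qed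
  show ?thesis using inv q by metis
qed

subsection \<open>Tile sets with input\<close>

definition hedges :: "com \<Rightarrow> nat \<Rightarrow> hedge option set" where
  "hedges c K = fst ` wang c K \<union> (fst \<circ> snd) ` wang c K"

definition vedges :: "com \<Rightarrow> nat \<Rightarrow> vedge option set" where
  "vedges c K = (fst \<circ> snd \<circ> snd) ` wang c K \<union> (snd \<circ> snd \<circ> snd) ` wang c K"

text \<open>An edge of the first row inside the input; \<open>eF\<close> is the edge at its end. The
  first test has the outcome \<open>test c = 0\<close> because only register \<open>0\<close> is
  positive initially.\<close>

definition eT :: "com \<Rightarrow> hedge option" where
  "eT c = Some (True, test c = 0, {0}, {0})"

definition eF :: "com \<Rightarrow> hedge option" where
  "eF c = Some (True, test c = 0, {0}, {})"

definition seed :: "com \<Rightarrow> nat \<Rightarrow> (hedge, vedge) col" where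
  "seed c K = Sea None (eT c) None (Some (True, next_com c (test c = 0),
    next_cell K True (next_op c (test c = 0)) {} {0} {0})) False False"

text \<open>Intervals from the boundary: here one ending inside the input, and for
  \<open>spine_end\<close> the one ending exactly at its end.\<close>

definition spine_mid :: "com \<Rightarrow> (hedge, vedge) col" where
  "spine_mid c = Up False (Some (None, eT c, eT c))"

definition spine_end :: "com \<Rightarrow> (hedge, vedge) col" where
  "spine_end c = Up False (Some (None, eT c, eF c))"

text \<open>Above a copy of \<open>spine_mid\<close>, its neighbour along \<open>b\<close> stores no
  interval; below a copy at level at least \<open>2\<close>, that neighbour is
  \<open>spine_right\<close>, the right half of the interval.\<close>

definition off_spine :: "(hedge, vedge) col" where
  "off_spine = Up False None"

definition spine_right :: "com \<Rightarrow> (hedge, vedge) col" where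
  "spine_right c = Up False (Some (eT c, eT c, eT c))"

lemmas special_defs = seed_def spine_mid_def spine_end_def off_spine_def spine_right_def eT_def eF_def

definition cols :: "com \<Rightarrow> nat \<Rightarrow> (hedge, vedge) col set" where
  "cols c K = {seed c K, spine_mid c, spine_end c, off_spine, spine_right c} \<union>
    (\<lambda>((w, e, s, n), p, q). Sea w e s n p q) ` (wang c K \<times> UNIV) \<union>
    (\<lambda>(x, I). Up x I) ` (UNIV \<times> insert None (Some ` (hedges c K \<times> hedges c K \<times> hedges c K))) \<union>
    (\<lambda>(x, I). Dn x I) ` (UNIV \<times> insert None (Some ` (vedges c K \<times> vedges c K \<times> vedges c K)))"

lemma finite_cols: "finite (cols c K)"
  by (simp add: cols_def hedges_def vedges_def finite_wang)

lemma special_in_cols: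
  "seed c K \<in> cols c K" "spine_mid c \<in> cols c K" "spine_end c \<in> cols c K"
  "off_spine \<in> cols c K" "spine_right c \<in> cols c K"
  by (simp_all add: cols_def)

lemma special_distinct:
  "distinct [seed c K, spine_mid c, spine_end c, off_spine, spine_right c]"
  by (simp add: special_defs)

lemma seed_wang:
  assumes "K > 0" "c \<noteq> Skip" "seed c K = Sea w e s n p q"
  shows "(w, e, s, n) \<in> wang c K"
proof -
  have "(w, e, s, n) = tile K True True c (test c = 0) {} {0} {0}"
    using assms(3) by (simp add: seed_def tile_def eT_def)
  also have "\<dots> \<in> wang c K"
    by (rule tile_wangI) (use assms(1,2) states_self[of c] in auto)
  finally show ?thesis .
qed

lemma cols_Sea:
  assumes "K > 0" "c \<noteq> Skip" "Sea w e s n p q \<in> cols c K"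
  shows "(w, e, s, n) \<in> wang c K"
proof -
  have "seed c K = Sea w e s n p q \<or> (w, e, s, n) \<in> wang c K"
    using assms(3) unfolding cols_def
    by (auto simp: spine_mid_def spine_end_def off_spine_def spine_right_def)
  then show ?thesis using seed_wang[OF assms(1,2)] by blast
qed

text \<open>The restriction on \<open>a\<close>-edges out of \<open>seed\<close> and \<open>spine_mid\<close> leaves the chain of \<open>chain_edge\<close>
  as the only way up from the seed.\<close>

definition base_edge :: "com \<Rightarrow> nat \<Rightarrow> bool \<Rightarrow> (hedge, vedge) col \<Rightarrow> (hedge, vedge) col \<Rightarrow> bool" where
  "base_edge c K \<beta> u v \<longleftrightarrow> u \<in> cols c K \<and> v \<in> cols c K \<and> rule \<beta> u v \<and>
    (\<not> \<beta> \<longrightarrow> u \<noteq> spine_mid c \<and> (u = seed c K \<longrightarrow> v = spine_mid c))"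

text \<open>Copies of \<open>spine_mid\<close> with the odd numbers \<open>1, \<dots>, 2 * n + 1\<close> count the levels from \<open>1\<close> to
  \<open>n + 1\<close> of the spine above the seed, so that the interval of \<open>spine_end\<close> at level \<open>n + 2\<close> makes
  \<open>2 ^ (n + 2)\<close> the input. The numbers \<open>2\<close>, \<open>4\<close>, \<open>6\<close> are those of \<open>spine_end\<close>, \<open>off_spine\<close>,
  \<open>spine_right\<close>.\<close>

definition chain_edge :: "nat \<Rightarrow> bool \<Rightarrow> nat \<Rightarrow> nat \<Rightarrow> bool" where
  "chain_edge n \<beta> i j \<longleftrightarrow>
    (\<not> \<beta> \<and> ((\<exists>k<n. i = 2 * k + 1 \<and> j = 2 * k + 3) \<or> i = 2 * n + 1 \<and> j = 2)) \<or>
    (\<beta> \<and> (\<exists>k<n. i = 2 * k + 3 \<and> j = 4 \<or> i = 6 \<and> j = 2 * k + 3))"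

lemma chain_edgeI:
  "k < n \<Longrightarrow> chain_edge n False (2 * k + 1) (2 * k + 3)" "chain_edge n False (2 * n + 1) 2"
  "k < n \<Longrightarrow> chain_edge n True (2 * k + 3) 4" "k < n \<Longrightarrow> chain_edge n True 6 (2 * k + 3)"
  by (auto simp: chain_edge_def)

text \<open>Colours other than \<open>spine_mid\<close> have even numbers, so the odd numbers from
  \<open>3\<close> on are free for a chain of any length, and the numbering does not depend on that
  length.\<close>

locale numbered_program =
  fixes c :: com and K :: nat and \<nu> :: "(hedge, vedge) col \<Rightarrow> nat"
  assumes regs: "regs_below K c" "K > 0" and not_Skip: "c \<noteq> Skip"
    and inj: "inj_on \<nu> (cols c K)"
    and \<nu>: "\<nu> (seed c K) = 0" "\<nu> (spine_mid c) = 1" "\<nu> (spine_end c) = 2"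
      "\<nu> off_spine = 4" "\<nu> (spine_right c) = 6"
    and odd: "\<And>u. odd (\<nu> u) \<Longrightarrow> u = spine_mid c"
begin

definition num_base :: "bool \<Rightarrow> nat \<Rightarrow> nat \<Rightarrow> bool" where
  "num_base \<beta> i j \<longleftrightarrow> (\<exists>u v. i = \<nu> u \<and> j = \<nu> v \<and> base_edge c K \<beta> u v)"

definition num_edge :: "nat \<Rightarrow> bool \<Rightarrow> nat \<Rightarrow> nat \<Rightarrow> bool" where
  "num_edge n \<beta> i j \<longleftrightarrow> num_base \<beta> i j \<or> chain_edge n \<beta> i j"

text \<open>Forgetting the position in the chain turns a tiling for \<open>num_edge\<close> into one
  for \<open>rule\<close>.\<close>

definition decode :: "nat \<Rightarrow> (hedge, vedge) col" where
  "decode i = (if odd i then spine_mid c else inv_into (cols c K) \<nu> i)"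

lemma decode_\<nu>: "u \<in> cols c K \<Longrightarrow> decode (\<nu> u) = u"
  using odd[of u] inv_into_f_f[OF inj] by (auto simp: decode_def)

lemma decode_simps:
  "decode 0 = seed c K" "decode 2 = spine_end c" "decode 4 = off_spine" "decode 6 = spine_right c"
  "decode (2 * k + 1) = spine_mid c" "decode (2 * k + 3) = spine_mid c"
  using decode_\<nu> special_in_cols[of c K] \<nu> by (metis, metis, metis, metis, simp_all add: decode_def)

lemma rule_special:
  "rule False (spine_mid c) (spine_mid c)" "rule False (spine_mid c) (spine_end c)"
  "rule True (spine_mid c) off_spine" "rule True (spine_right c) (spine_mid c)"
  by (simp_all add: special_defs rule_def)

lemma num_edge_decode:
  assumes "num_edge n \<beta> i j"
  shows "rule \<beta> (decode i) (decode j)" "decode i \<in> cols c K"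
  using assms special_in_cols[of c K]
  unfolding num_edge_def num_base_def chain_edge_def base_edge_def
  by (auto simp: decode_\<nu> decode_simps rule_special simp del: One_nat_def add_2_eq_Suc' numeral_3_eq_3)

lemma num_edge_spine:
  "num_edge n False 0 j \<Longrightarrow> j = 1"
  "k < n \<Longrightarrow> num_edge n False (2 * k + 1) j \<Longrightarrow> j = 2 * k + 3"
  "num_edge n False (2 * n + 1) j \<Longrightarrow> j = 2"
proof -
  have odd_base: "\<not> num_base False (2 * k + 1) j" for k j
  proof
    assume "num_base False (2 * k + 1) j"
    then obtain u v where "\<nu> u = 2 * k + 1" "base_edge c K False u v"
      unfolding num_base_def by metis
    then show False using odd[of u] by (simp add: base_edge_def)
  qed
  show "k < n \<Longrightarrow> num_edge n False (2 * k + 1) j \<Longrightarrow> j = 2 * k + 3"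
    "num_edge n False (2 * n + 1) j \<Longrightarrow> j = 2"
    using odd_base[of k j] odd_base[of n j] by (auto simp: num_edge_def chain_edge_def)
  assume "num_edge n False 0 j"
  then obtain u v where uv: "\<nu> u = 0" "j = \<nu> v" "base_edge c K False u v"
    by (auto simp: num_edge_def chain_edge_def num_base_def)
  then have "u = seed c K"
    using inj_onD[OF inj, of u "seed c K"] \<nu>(1) special_in_cols(1) by (simp add: base_edge_def)
  then show "j = 1" using uv \<nu>(2) by (simp add: base_edge_def)
qed

text \<open>Decoded, level \<open>0\<close> is a Wang tiling. Before decoding, the chain forces the
  spine up to \<open>spine_end\<close> at level \<open>n + 2\<close>, which puts \<open>eF\<close>
  after \<open>2 ^ (n + 2)\<close> columns.\<close>

lemma run_of_tiling:
  assumes t: "tiling (num_edge n) \<psi>" and seed: "\<psi> 0 0 0 = 0"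
  shows "fst (run c (2 ^ (n + 2)) t) \<noteq> Skip"
proof -
  define \<phi> where "\<phi> x y m = decode (\<psi> x y m)" for x y m
  have up: "num_edge n \<beta> (\<psi> x y (int j)) (\<psi> x (fl \<beta> j y) (int j + 1))" for \<beta> x y j
    using t by (simp add: tiling_def)
  have "tiling rule \<phi>"
    using t num_edge_decode(1) unfolding tiling_def \<phi>_def by blast
  have cols: "\<phi> x y 0 \<in> cols c K" for x y
    using num_edge_decode(2)[OF up[of False x y 0]] by (simp add: \<phi>_def)
  have wang: "(west (\<phi> x y 0), east (\<phi> x y 0), south (\<phi> x y 0), north (\<phi> x y 0)) \<in> wang c K"
    if "is_sea (\<phi> x y 0)" for x y
    using that cols[of x y] cols_Sea[OF regs(2) not_Skip] by (cases "\<phi> x y 0") auto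
  have \<phi>0: "\<phi> 0 0 0 = Sea None (eT c) None (Some (True, next_com c (test c = 0),
    next_cell K True (next_op c (test c = 0)) {} {0} {0})) False False"
    using seed by (simp add: \<phi>_def decode_simps seed_def)
  have row: "\<forall>x y. is_sea (\<phi> x y 0) \<and> is_sea (\<phi> x (Suc y) 0) \<and>
      east (\<phi> x y 0) = west (\<phi> x (Suc y) 0) \<and>
      south (\<phi> x y 0) = None \<longrightarrow> south (\<phi> x (Suc y) 0) = None"
    using wang_boundary(1)[OF wang wang] by blast
  have column: "\<forall>x y. is_sea (\<phi> x y 0) \<and> is_sea (\<phi> (Suc x) y 0) \<and>
      north (\<phi> x y 0) = south (\<phi> (Suc x) y 0) \<and>
      west (\<phi> x y 0) = None \<longrightarrow> west (\<phi> (Suc x) y 0) = None"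
    using wang_boundary(2)[OF wang wang] by blast
  note quadrant = quadrant_of_tiling[OF \<open>tiling rule \<phi>\<close> \<phi>0 row column]
  have spine: "\<psi> 0 0 (int (Suc j)) = 2 * j + 1" if "j \<le> n" for j
    using that
  proof (induction j)
    case 0
    have "num_edge n False 0 (\<psi> 0 0 1)" using up[of False 0 0 0] seed by simp
    from num_edge_spine(1)[OF this] show ?case by simp
  next
    case (Suc j)
    then have "num_edge n False (2 * j + 1) (\<psi> 0 0 (int (Suc (Suc j))))"
      using up[of False 0 0 "Suc j"] by (simp add: add.commute)
    from num_edge_spine(2)[OF _ this] Suc.prems show ?case by simp
  qed
  have "\<psi> 0 0 (int (n + 2)) = 2"
    using num_edge_spine(3)[of n] up[of False 0 0 "Suc n"] spine[of n] by (simp add: algebra_simps)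
  then have "\<phi> 0 0 (int (n + 2)) = Up False (Some (None, eT c, eF c))"
    by (simp add: \<phi>_def decode_simps spine_end_def)
  from quadrant(6)[OF this] have input: "east (\<phi> 0 (2 ^ (n + 2) - 1) 0) = eF c" by simp
  show ?thesis
    by (rule wang_run[OF regs _ wang[OF quadrant(1)] quadrant(2,3,4,5) input[unfolded eF_def]]) simp
qed

text \<open>The run colours the quadrant, and the spine up to level \<open>n + 1\<close> is
  renumbered by the chain. For this, \<open>spine_mid\<close> and \<open>seed\<close> must occur
  only where the chain expects them.\<close>

lemma tiling_of_run:
  assumes run: "\<And>t. fst (run c (2 ^ (n + 2)) t) \<noteq> Skip"
  shows "\<exists>\<psi>. tiling (num_edge n) \<psi> \<and> \<psi> 0 0 0 = 0"
proof -
  define i :: nat where "i = 2 ^ (n + 2)"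
  have "i > 0" by (simp add: i_def)
  define h where "h = run_h c K i"
  define v where "v = run_v c K i"
  define \<phi> where "\<phi> = quadrant_col h v"
  have wang: "(h x y, h x (Suc y), v x y, v (Suc x) y) \<in> wang c K" for x y
    unfolding h_def v_def by (rule run_wang[OF regs \<open>i > 0\<close>]) (use run in \<open>simp add: i_def\<close>)
  have h_None: "h x y = None \<longleftrightarrow> y = 0" and v_None: "v x y = None \<longleftrightarrow> x = 0" for x y
    by (simp_all add: h_def v_def run_h_def run_v_def)
  have tiling: "tiling rule \<phi>"
    unfolding \<phi>_def by (rule tiling_of_quadrant[OF h_None v_None])
  have hH: "h x y \<in> hedges c K" and vV: "v x y \<in> vedges c K" for x y
    using wang[of x y] unfolding hedges_def vedges_def by (force simp: image_iff)+
  have cols: "\<phi> x y m \<in> cols c K" for x y m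
  proof -
    consider "m = 0" | "m > 0" | "m < 0" by linarith
    then show ?thesis
    proof cases
      case 1
      then have "\<phi> x y m = (\<lambda>((w, e, s, n), p, q). Sea w e s n p q)
          ((h x y, h x (Suc y), v x y, v (Suc x) y), odd y, odd x)"
        by (simp add: \<phi>_def quadrant_col_def)
      then show ?thesis using wang[of x y] unfolding cols_def by blast
    next
      case 2
      then obtain x' I where "\<phi> x y m = (\<lambda>(x, I). Up x I) (x', I)"
        "I \<in> insert None (Some ` (hedges c K \<times> hedges c K \<times> hedges c K))"
        using hH by (simp add: \<phi>_def quadrant_col_def interval_col_def image_iff)
      then show ?thesis unfolding cols_def by blast
    next
      case 3
      then obtain x' I where "\<phi> x y m = (\<lambda>(x, I). Dn x I) (x', I)"
        "I \<in> insert None (Some ` (vedges c K \<times> vedges c K \<times> vedges c K))"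
        using vV by (simp add: \<phi>_def quadrant_col_def interval_col_def image_iff)
      then show ?thesis unfolding cols_def by blast
    qed
  qed
  have test0: "test_result c i 0 = (test c = 0)"
    using \<open>i > 0\<close> by (simp add: test_result_def run_0)
  have h0: "h 0 y = (if y < i then eT c else eF c)" if "0 < y" "y \<le> i" for y
    using that by (auto simp: h_def run_h_def cell_0 regs test0 eT_def eF_def)
  have h0_T: "h x y = eT c \<Longrightarrow> x = 0 \<and> y < i" for x y
    by (cases "x = 0") (auto simp: h_def run_h_def cell_0 regs eT_def split: if_splits)
  have "1 < i" unfolding i_def by (rule one_less_power) simp_all
  have v1: "v (Suc 0) 0 = Some (True, next_com c (test c = 0),
      next_cell K True (next_op c (test c = 0)) {} {0} {0})"
    using cell_Suc[OF regs, of i 0 0 "{}"] test0 \<open>1 < i\<close>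
    by (simp add: v_def run_v_def run_Suc Let_def run_0 cell_0 regs test_result_def)
  have pow: "2 ^ j < i \<longleftrightarrow> j < n + 2" "2 ^ j \<le> i \<longleftrightarrow> j \<le> n + 2" for j
    by (simp_all add: i_def power_strict_increasing_iff del: power_Suc power_Suc2)
  have \<phi>_seed: "\<phi> 0 0 0 = seed c K"
    using h0[of 1] \<open>1 < i\<close> h_None v_None v1
    by (simp add: \<phi>_def quadrant_col_def seed_def)
  have \<phi>_spine: "\<phi> 0 0 (int (Suc j)) = (if j \<le> n then spine_mid c else spine_end c)"
    if "j \<le> n + 1" for j
  proof -
    have "h 0 (2 ^ j) = eT c" using that pow[of j] by (simp add: h0)
    moreover have "h 0 (2 ^ Suc j) = (if j \<le> n then eT c else eF c)"
      using that pow[of "Suc j"] by (subst h0) (auto simp del: power_Suc)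
    ultimately show ?thesis
      using h_None[of 0 0]
      by (simp add: \<phi>_def quadrant_col_def interval_col_def spine_mid_def spine_end_def nat_add_distrib)
  qed
  have \<phi>_off: "\<phi> 0 (2 ^ Suc j) (int (Suc (Suc j))) = off_spine" for j
    by (simp add: \<phi>_def quadrant_col_def interval_col_def off_spine_def nat_add_distrib)
  have \<phi>_right: "\<phi> 0 (2 ^ Suc j) (int (Suc j)) = spine_right c" if "j < n" for j
  proof -
    have *: "(2::nat) ^ Suc j + 2 ^ j < 2 ^ Suc (Suc j)" "(2::nat) ^ Suc (Suc j) = 2 ^ Suc j + 2 ^ Suc j"
      by simp_all
    have "2 ^ Suc (Suc j) < i" "2 ^ Suc j < i" using that pow(1) by (simp_all del: power_Suc)
    moreover from this have "2 ^ Suc j + 2 ^ j < i" using *(1) by linarith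
    moreover have "h 0 y = eT c" if "0 < y" "y < i" for y using h0[of y] that by simp
    ultimately have "h 0 (2 ^ Suc j) = eT c" "h 0 (2 ^ Suc j + 2 ^ j) = eT c"
      "h 0 (2 ^ Suc j + 2 ^ Suc j) = eT c"
      using *(2) by (metis add_pos_pos zero_less_numeral zero_less_power)+
    then show ?thesis
      by (simp add: \<phi>_def quadrant_col_def interval_col_def spine_right_def nat_add_distrib)
  qed
  \<comment> \<open>The edge \<open>eT\<close> occurs only in the first row before position
    \<open>i = 2 ^ (n + 2)\<close>, which bounds the level.\<close>
  have \<phi>_mid: "x = 0 \<and> y = 0 \<and> (\<exists>j\<le>n. m = int (Suc j))" if "\<phi> x y m = spine_mid c" for x y m
  proof -
    have "m > 0" using that
      by (cases "m = 0"; cases "m < 0") (auto simp: \<phi>_def quadrant_col_def interval_col_def spine_mid_def)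
    then have "h x y = None" "h x (y + 2 ^ nat m) = eT c"
      using that by (auto simp: \<phi>_def quadrant_col_def interval_col_def spine_mid_def split: if_splits)
    then have "x = 0" "y = 0" "2 ^ nat m < i" using h_None h0_T by auto
    then show ?thesis using pow(1)[of "nat m"] \<open>m > 0\<close>
      by (intro conjI exI[of _ "nat m - 1"]) auto
  qed
  have \<phi>_seedD: "x = 0 \<and> y = 0 \<and> m = 0" if "\<phi> x y m = seed c K" for x y m
  proof -
    have "m = 0" using that
      by (cases "m = 0"; cases "m < 0") (auto simp: \<phi>_def quadrant_col_def interval_col_def seed_def)
    then show ?thesis using that h_None v_None by (auto simp: \<phi>_def quadrant_col_def seed_def)
  qed
  define \<psi> where "\<psi> x y m = (if x = 0 \<and> y = 0 \<and> 1 \<le> m \<and> m \<le> int n + 1 then nat (2 * m - 1)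
    else \<nu> (\<phi> x y m))" for x y m
  have base: "num_edge n \<beta> (\<nu> (\<phi> x y m)) (\<nu> (\<phi> x' y' m'))"
    if "rule \<beta> (\<phi> x y m) (\<phi> x' y' m')"
      "\<not> \<beta> \<Longrightarrow> \<phi> x y m \<noteq> spine_mid c \<and> (\<phi> x y m = seed c K \<longrightarrow> \<phi> x' y' m' = spine_mid c)"
    for \<beta> x y m x' y' m'
    using that cols unfolding num_edge_def num_base_def base_edge_def by blast
  have \<psi>_spine: "\<psi> 0 0 (int (Suc j)) = 2 * j + 1" if "j \<le> n" for j
    using that by (simp add: \<psi>_def nat_add_distrib)
  \<comment> \<open>At level \<open>1\<close> the chain number agrees with
    \<open>\<nu> (spine_mid c) = 1\<close>, so the exceptions start at level
    \<open>2\<close>.\<close>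
  have \<psi>_eq: "\<psi> x y m = \<nu> (\<phi> x y m)" if "\<not> (x = 0 \<and> y = 0 \<and> 2 \<le> m \<and> m \<le> int n + 1)" for x y m
    using that \<phi>_spine[of 0] \<nu>(2) by (cases "m = 1") (auto simp: \<psi>_def)
  have upper: "num_edge n \<beta> (\<psi> x y (int j)) (\<psi> x (fl \<beta> j y) (int (Suc j)))" for \<beta> x y j
  proof -
    have r: "rule \<beta> (\<phi> x y (int j)) (\<phi> x (fl \<beta> j y) (int (Suc j)))"
      using tiling by (simp add: tiling_def add.commute)
    \<comment> \<open>The first three cases are the edges of the chain: up the spine along
      \<open>a\<close>, and along \<open>b\<close> out of or into a copy at level at least
      \<open>2\<close>. In the last case both ends keep their number under
      \<open>\<nu>\<close>.\<close>
    consider (src) k where "\<not> \<beta>" "x = 0" "y = 0" "j = Suc k" "k \<le> n"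
      | (srcb) k where "\<beta>" "x = 0" "y = 0" "j = Suc (Suc k)" "k < n"
      | (tgtb) k where "\<beta>" "x = 0" "y = 2 ^ j" "j = Suc k" "k < n"
      | (other) "\<not> (x = 0 \<and> y = 0 \<and> 2 \<le> j \<and> j \<le> n + 1)"
          "\<not> (x = 0 \<and> fl \<beta> j y = 0 \<and> 1 \<le> j \<and> j \<le> n)"
          "\<beta> \<or> \<not> (x = 0 \<and> y = 0 \<and> 1 \<le> j \<and> j \<le> n + 1)"
    proof -
      have fl0: "fl True j y = 0 \<Longrightarrow> y = 2 ^ j"
        using fl_unset[of 0 j] fl_fl[of True j y] by simp
      show ?thesis
      proof (cases \<beta>)
        case False
        then show ?thesis
          using src[of "j - 1"] other by (cases "x = 0 \<and> y = 0 \<and> 1 \<le> j \<and> j \<le> n + 1") auto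
      next
        case True
        consider "x = 0 \<and> y = 0 \<and> 2 \<le> j \<and> j \<le> n + 1" | "x = 0 \<and> fl True j y = 0 \<and> 1 \<le> j \<and> j \<le> n"
          | "\<not> (x = 0 \<and> y = 0 \<and> 2 \<le> j \<and> j \<le> n + 1)"
            "\<not> (x = 0 \<and> fl True j y = 0 \<and> 1 \<le> j \<and> j \<le> n)"
          by blast
        then show ?thesis
        proof cases
          case 1
          then have "j = Suc (Suc (j - 2))" "j - 2 < n" by linarith+
          then show ?thesis using 1 True srcb by blast
        next
          case 2
          then have "j = Suc (j - 1)" "j - 1 < n" by linarith+
          then show ?thesis using 2 True tgtb fl0 by blast
        next
          case 3
          then show ?thesis using True by (intro other) simp_all
        qed
      qed
    qed
    then show ?thesis
    proof cases
      case src
      show ?thesis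
      proof (cases "k = n")
        case True
        have "\<psi> 0 0 (int (Suc (Suc n))) = 2"
          using \<psi>_eq[of 0 0 "int (Suc (Suc n))"] \<phi>_spine[of "Suc n"] \<nu>(3) by simp
        then show ?thesis using src True \<psi>_spine[of n] chain_edgeI(2)[of n] by (simp add: num_edge_def)
      next
        case False
        then show ?thesis using src \<psi>_spine[of k] \<psi>_spine[of "Suc k"] chain_edgeI(1)[of k n]
          by (simp add: num_edge_def numeral_3_eq_3 del: of_nat_Suc)
      qed
    next
      case srcb
      have "fl \<beta> j y = 2 ^ Suc (Suc k)" using srcb fl_unset[of 0 j] by simp
      moreover have "\<psi> 0 (2 ^ Suc (Suc k)) (int (Suc (Suc (Suc k)))) = 4"
        using \<psi>_eq[of 0 "2 ^ Suc (Suc k)"] \<phi>_off[of "Suc k"] \<nu>(4) by simp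
      ultimately show ?thesis using srcb \<psi>_spine[of "Suc k"] chain_edgeI(3)[of k n]
        by (simp add: num_edge_def numeral_3_eq_3 del: of_nat_Suc power_Suc)
    next
      case tgtb
      have "fl \<beta> j y = 0" using tgtb fl_fl[of True j 0] fl_unset[of 0 j] by simp
      moreover have "\<psi> 0 (2 ^ Suc k) (int (Suc k)) = 6"
        using \<psi>_eq[of 0 "2 ^ Suc k"] \<phi>_right[of k] tgtb \<nu>(5) by simp
      ultimately show ?thesis using tgtb \<psi>_spine[of "Suc k"] chain_edgeI(4)[of k n]
        by (simp add: num_edge_def numeral_3_eq_3 del: of_nat_Suc power_Suc)
    next
      case other
      have "\<not> \<beta> \<Longrightarrow> \<phi> x y (int j) \<noteq> spine_mid c"
        using \<phi>_mid[of x y "int j"] other(3) by auto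
      moreover have "\<phi> x (fl \<beta> j y) (int (Suc j)) = spine_mid c" if "\<not> \<beta>" "\<phi> x y (int j) = seed c K"
        using \<phi>_seedD[OF that(2)] that(1) \<phi>_spine[of 0] by simp
      moreover have "\<psi> x y (int j) = \<nu> (\<phi> x y (int j))"
        by (rule \<psi>_eq) (use other(1) in auto)
      moreover have "\<psi> x (fl \<beta> j y) (int (Suc j)) = \<nu> (\<phi> x (fl \<beta> j y) (int (Suc j)))"
        by (rule \<psi>_eq) (use other(2) in auto)
      ultimately show ?thesis using base[OF r] by simp
    qed
  qed
  have lower: "num_edge n \<beta> (\<psi> x y (- int j - 1)) (\<psi> (fl \<beta> j x) y (- int j))" for \<beta> x y j
  proof -
    have r: "rule \<beta> (\<phi> x y (- int j - 1)) (\<phi> (fl \<beta> j x) y (- int j))"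
      using tiling by (simp add: tiling_def)
    have "\<phi> x y (- int j - 1) \<noteq> spine_mid c" "\<phi> x y (- int j - 1) \<noteq> seed c K"
      using \<phi>_mid[of x y "- int j - 1"] \<phi>_seedD[of x y "- int j - 1"] by auto
    then show ?thesis using base[OF r] \<psi>_eq by simp
  qed
  have "tiling (num_edge n) \<psi>"
    unfolding tiling_def using upper lower by (simp add: add.commute)
  moreover have "\<psi> 0 0 0 = 0" using \<psi>_eq[of 0 0 0] \<phi>_seed \<nu>(1) by simp
  ultimately show ?thesis by blast
qed

end

lemma ex_numbering:
  "\<exists>\<nu>. inj_on \<nu> (cols c K) \<and> \<nu> (seed c K) = (0::nat) \<and> \<nu> (spine_mid c) = 1 \<and> \<nu> (spine_end c) = 2 \<and>
    \<nu> off_spine = 4 \<and> \<nu> (spine_right c) = 6 \<and> (\<forall>u. odd (\<nu> u) \<longrightarrow> u = spine_mid c)"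
proof -
  obtain f :: "(hedge, vedge) col \<Rightarrow> nat" where f: "inj_on f (cols c K)"
    using finite_imp_inj_to_nat_seg[OF finite_cols] by blast
  define \<nu> where "\<nu> u = (if u = seed c K then 0 else if u = spine_mid c then 1
    else if u = spine_end c then 2 else if u = off_spine then 4
    else if u = spine_right c then 6 else 2 * f u + 8)" for u
  have "inj_on \<nu> (cols c K)"
    using f by (auto simp: inj_on_def \<nu>_def split: if_splits)
  moreover have "\<nu> (seed c K) = 0" "\<nu> (spine_mid c) = 1" "\<nu> (spine_end c) = 2"
    "\<nu> off_spine = 4" "\<nu> (spine_right c) = 6"
    using special_distinct[of c K] by (auto simp: \<nu>_def)
  moreover have "\<forall>u. odd (\<nu> u) \<longrightarrow> u = spine_mid c" by (auto simp: \<nu>_def)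
  ultimately show ?thesis by blast
qed

subsection \<open>Codes of instances and diagonalisation\<close>

definition ec :: "nat \<Rightarrow> nat \<Rightarrow> nat \<Rightarrow> nat" where
  "ec i k j = prod_encode (i, prod_encode (k, j))"

lemma ec_eq_iff [simp]: "ec i k j = ec i' k' j' \<longleftrightarrow> i = i' \<and> k = k' \<and> j = j'"
  by (simp add: ec_def prod_encode_eq)

lemma edge_code_up_gen:
  "edge_code (i, up_gen \<beta>, j) = ec i (if \<beta> then 2 else 0) j"
  "edge_code (i, inv\<^bsub>lamplighter\<^esub> up_gen \<beta>, j) = ec i (if \<beta> then 3 else 1) j"
proof -
  have "lamp_gen_code (up_gen \<beta>) = (if \<beta> then 2 else 0)"
    "lamp_gen_code (inv\<^bsub>lamplighter\<^esub> up_gen \<beta>) = (if \<beta> then 3 else 1)"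
    using gens_distinct[of True False] gens_distinct[of False True] gens_distinct[of False False]
      gens_distinct[of True True]
    unfolding lamp_gen_code_def up_gen_def by (auto split: if_splits)
  then show "edge_code (i, up_gen \<beta>, j) = ec i (if \<beta> then 2 else 0) j"
    "edge_code (i, inv\<^bsub>lamplighter\<^esub> up_gen \<beta>, j) = ec i (if \<beta> then 3 else 1) j"
    by (simp_all add: edge_code_def ec_def)
qed

lemma edge_code_edges_of:
  "edge_code ` edges_of E = {ec i 0 j | i j. E False i j} \<union> {ec j 1 i | i j. E False i j} \<union>
    {ec i 2 j | i j. E True i j} \<union> {ec j 3 i | i j. E True i j}"
proof -
  have image: "f ` {F i j | i j. R i j} = {f (F i j) | i j. R i j}"
    for f :: "nat \<times> lamp \<times> nat \<Rightarrow> nat" and F :: "nat \<Rightarrow> nat \<Rightarrow> nat \<times> lamp \<times> nat" and R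
    by blast
  show ?thesis
    unfolding edges_of_def UNIV_bool image_UN image_Un image edge_code_up_gen
    by (simp only: UN_insert UN_empty if_True if_False Un_empty_right Un_assoc)
qed

lemma ec_mem_edges_of:
  "ec i k j \<in> edge_code ` edges_of E \<longleftrightarrow>
    k = 0 \<and> E False i j \<or> k = 1 \<and> E False j i \<or> k = 2 \<and> E True i j \<or> k = 3 \<and> E True j i"
  unfolding edge_code_edges_of by (simp only: Un_iff mem_Collect_eq ec_eq_iff) blast

lemma edges_of_mono: "(\<And>\<beta> i j. E \<beta> i j \<Longrightarrow> i \<in> A \<and> j \<in> A) \<Longrightarrow> edges_of E \<subseteq> A \<times> lamp_gens \<times> A"
  unfolding edges_of_def lamp_gens_eq by blast

lemma edges_of_disj:
  fixes E E' :: "bool \<Rightarrow> 'a \<Rightarrow> 'a \<Rightarrow> bool"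
  shows "edges_of (\<lambda>\<beta> i j. E \<beta> i j \<or> E' \<beta> i j) = edges_of E \<union> edges_of E'"
proof -
  have "{(u, g, v) | u v. P u v \<or> Q u v} = {(u, g, v) | u v. P u v} \<union> {(u, g, v) | u v. Q u v}"
    for g :: lamp and P Q :: "'a \<Rightarrow> 'a \<Rightarrow> bool"
    by (auto simp only: mem_Collect_eq Un_iff)
  moreover have "{(v, g, u) | u v. P u v \<or> Q u v} = {(v, g, u) | u v. P u v} \<union> {(v, g, u) | u v. Q u v}"
    for g :: lamp and P Q :: "'a \<Rightarrow> 'a \<Rightarrow> bool"
    by (auto simp only: mem_Collect_eq Un_iff)
  ultimately show ?thesis
    unfolding edges_of_def by (simp only: UN_Un_distrib Un_ac)
qed

text \<open>The edges that attach copy \<open>2 * k + 3\<close>, each with its inverse; generator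
  codes \<open>0\<close>, \<open>1\<close> belong to \<open>a\<close> and its inverse,
  \<open>2\<close>, \<open>3\<close> to \<open>b\<close> and its inverse.\<close>

definition link_codes :: "nat \<Rightarrow> nat set" where
  "link_codes k = {ec (2 * k + 1) 0 (2 * k + 3), ec (2 * k + 3) 1 (2 * k + 1),
    ec (2 * k + 3) 2 4, ec 4 3 (2 * k + 3), ec 6 2 (2 * k + 3), ec (2 * k + 3) 3 6}"

definition end_codes :: "nat \<Rightarrow> nat set" where
  "end_codes n = {ec (2 * n + 1) 0 2, ec 2 1 (2 * n + 1)}"

lemma edge_code_chain:
  "edge_code ` edges_of (chain_edge n) = (\<Union>k<n. link_codes k) \<union> end_codes n"
  unfolding edge_code_edges_of chain_edge_def link_codes_def end_codes_def
  by (auto simp del: One_nat_def)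

text \<open>Set codes are sums of powers of two, so disjoint unions become sums and the code of a
  chain is a computable function of its length.\<close>

definition link_weight :: "nat \<Rightarrow> nat" where
  "link_weight k = 2 ^ ec (2 * k + 1) 0 (2 * k + 3) + 2 ^ ec (2 * k + 3) 1 (2 * k + 1) +
    2 ^ ec (2 * k + 3) 2 4 + 2 ^ ec 4 3 (2 * k + 3) + 2 ^ ec 6 2 (2 * k + 3) + 2 ^ ec (2 * k + 3) 3 6"

definition end_weight :: "nat \<Rightarrow> nat" where
  "end_weight n = 2 ^ ec (2 * n + 1) 0 2 + 2 ^ ec 2 1 (2 * n + 1)"

lemma set_encode_Un_disjoint:
  "finite A \<Longrightarrow> finite B \<Longrightarrow> A \<inter> B = {} \<Longrightarrow> set_encode (A \<union> B) = set_encode A + set_encode B"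
  by (simp add: set_encode_def sum.union_disjoint)

lemma set_encode_link: "set_encode (link_codes k) = link_weight k"
  by (simp add: link_codes_def link_weight_def set_encode_def)

lemma set_encode_end: "set_encode (end_codes n) = end_weight n"
  by (simp add: end_codes_def end_weight_def set_encode_def)

lemma finite_codes [simp]: "finite (link_codes k)" "finite (end_codes n)"
  by (simp_all add: link_codes_def end_codes_def)

lemma link_codes_disjoint: "k \<noteq> l \<Longrightarrow> link_codes k \<inter> link_codes l = {}"
  by (auto simp: link_codes_def)

lemma link_end_codes_disjoint: "link_codes k \<inter> end_codes n = {}"
  by (auto simp: link_codes_def end_codes_def)

lemma set_encode_lessThan: "set_encode {..<m} = 2 ^ m - 1"
  by (induction m) (simp_all add: set_encode_def lessThan_Suc)

lemma ec_ge: "i \<le> ec i k j" "j \<le> ec i k j"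
  unfolding ec_def
  by (rule le_prod_encode_1) (rule order_trans[OF le_prod_encode_2 le_prod_encode_2])

lemma mem_less_set_encode: "finite A \<Longrightarrow> x \<in> A \<Longrightarrow> x < set_encode A"
proof -
  assume "finite A" "x \<in> A"
  then have "2 ^ x \<le> set_encode A" unfolding set_encode_def by (intro member_le_sum) auto
  then show "x < set_encode A" using less_exp[of x] by linarith
qed

text \<open>The instance with base edges coded by \<open>p\<close>, a chain of length
  \<open>p\<close> and seed \<open>0\<close>; its colours, all numbers below
  \<open>3 * p + 2\<close>, include the copies up to \<open>2 * p + 1\<close>.\<close>

definition instance_number :: "nat \<Rightarrow> nat" where
  "instance_number p = prod_encode (2 ^ (3 * p + 2) - 1,
    prod_encode (p + ((\<Sum>k<p. link_weight k) + end_weight p), 0))"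

section \<open>The instance belonging to a program\<close>

context numbered_program
begin

definition base_code :: nat where
  "base_code = set_encode (edge_code ` edges_of num_base)"

definition colours :: "nat set" where
  "colours = {..<3 * base_code + 2}"

lemma num_base_colours: "num_base \<beta> i j \<Longrightarrow> i \<in> \<nu> ` cols c K \<and> j \<in> \<nu> ` cols c K"
  by (auto simp: num_base_def base_edge_def)

lemma finite_base: "finite (edge_code ` edges_of num_base)"
proof -
  have "edges_of num_base \<subseteq> \<nu> ` cols c K \<times> lamp_gens \<times> \<nu> ` cols c K"
    using num_base_colours by (rule edges_of_mono)
  moreover have "finite lamp_gens" by (simp add: lamp_gens_def)
  ultimately show ?thesis by (meson finite_SigmaI finite_cols finite_imageI finite_subset)
qed

lemma num_base_odd:
  assumes "num_base \<beta> i j"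
  shows "odd i \<Longrightarrow> i = 1 \<and> \<beta>" "odd j \<Longrightarrow> j = 1"
proof -
  obtain u v where uv: "i = \<nu> u" "j = \<nu> v" "base_edge c K \<beta> u v"
    using assms unfolding num_base_def by blast
  show "odd i \<Longrightarrow> i = 1 \<and> \<beta>" using odd[of u] \<nu>(2) uv by (auto simp: base_edge_def)
  show "odd j \<Longrightarrow> j = 1" using odd[of v] \<nu>(2) uv by simp
qed

text \<open>Up to inversion, a chain edge has an odd endpoint above \<open>1\<close> or leaves
  \<open>1\<close> along \<open>a\<close>; neither happens among the base edges.\<close>

lemma base_chain_disjoint:
  "edge_code ` edges_of num_base \<inter> ((\<Union>k<n. link_codes k) \<union> end_codes n) = {}"
proof -
  have odd_colour: "\<not> num_base \<beta> (2 * k + 3) j" "\<not> num_base \<beta> j (2 * k + 3)"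
    "\<not> num_base False (Suc (2 * k)) j" for \<beta> j k
    using num_base_odd[of \<beta> "2 * k + 3" j] num_base_odd[of \<beta> j "2 * k + 3"]
      num_base_odd[of False "Suc (2 * k)" j] by auto
  define B where "B = edge_code ` edges_of num_base"
  note mem = ec_mem_edges_of[of _ _ _ num_base, folded B_def]
  have "x \<notin> B" if "x \<in> link_codes k" for x k
    using that unfolding link_codes_def by (auto simp: mem odd_colour)
  moreover have "x \<notin> B" if "x \<in> end_codes n" for x
    using that unfolding end_codes_def by (auto simp: mem odd_colour)
  ultimately show ?thesis unfolding B_def by blast
qed

lemma edge_code_num_edge:
  "set_encode (edge_code ` edges_of (num_edge n)) = base_code + ((\<Sum>k<n. link_weight k) + end_weight n)"
proof -
  have "num_edge n = (\<lambda>\<beta> i j. num_base \<beta> i j \<or> chain_edge n \<beta> i j)"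
    by (simp add: num_edge_def fun_eq_iff)
  then have eq: "edge_code ` edges_of (num_edge n) =
      edge_code ` edges_of num_base \<union> ((\<Union>k<n. link_codes k) \<union> end_codes n)"
    by (simp only: edges_of_disj image_Un edge_code_chain)
  have "set_encode (\<Union>k<n. link_codes k) = (\<Sum>k<n. link_weight k)"
    unfolding set_encode_link[symmetric] unfolding set_encode_def
    by (rule sum.UNION_disjoint) (use link_codes_disjoint in auto)
  moreover have "(\<Union>k<n. link_codes k) \<inter> end_codes n = {}" using link_end_codes_disjoint by blast
  ultimately show ?thesis
    unfolding eq base_code_def
    by (simp add: set_encode_Un_disjoint finite_base base_chain_disjoint set_encode_end)
qed

lemma num_base_less: "num_base \<beta> i j \<Longrightarrow> i < base_code \<and> j < base_code"
proof -
  assume b: "num_base \<beta> i j"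
  then have "edge_code (i, up_gen \<beta>, j) \<in> edge_code ` edges_of num_base" by (intro imageI) simp
  then have "ec i (if \<beta> then 2 else 0) j < base_code"
    unfolding base_code_def edge_code_up_gen(1) by (rule mem_less_set_encode[OF finite_base])
  then show ?thesis using ec_ge by (meson le_less_trans)
qed

lemma instance_valid:
  "finite colours" "edges_of (num_edge base_code) \<subseteq> colours \<times> lamp_gens \<times> colours" "0 \<in> colours"
proof -
  \<comment> \<open>A base edge with colour \<open>4\<close> makes the code exceed \<open>4\<close>,
    so the fixed numbers up to \<open>6\<close> are below the bound on colours.\<close>
  have "num_base True 1 4"
    unfolding num_base_def base_edge_def
    using \<nu> special_in_cols rule_special by (intro exI[of _ "spine_mid c"] exI[of _ off_spine]) auto
  then have "4 < base_code" using num_base_less by blast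
  then show "edges_of (num_edge base_code) \<subseteq> colours \<times> lamp_gens \<times> colours"
    by (intro edges_of_mono) (auto simp: num_edge_def chain_edge_def colours_def dest: num_base_less)
qed (simp_all add: colours_def)

lemma instance_code_eq:
  "instance_code colours (edges_of (num_edge base_code)) 0 = instance_number base_code"
  unfolding instance_code_def edge_code_num_edge colours_def set_encode_lessThan instance_number_def ..

lemma colours_tileable_iff:
  "seeded_tileable lamplighter lamp_gens colours (edges_of (num_edge base_code)) 0 \<longleftrightarrow>
    (\<forall>t. fst (run c (2 ^ (base_code + 2)) t) \<noteq> Skip)"
proof
  assume "seeded_tileable lamplighter lamp_gens colours (edges_of (num_edge base_code)) 0"
  then show "\<forall>t. fst (run c (2 ^ (base_code + 2)) t) \<noteq> Skip"
    unfolding seeded_tileable_edges_of using run_of_tiling by blast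
next
  assume "\<forall>t. fst (run c (2 ^ (base_code + 2)) t) \<noteq> Skip"
  then obtain \<psi> where \<psi>: "tiling (num_edge base_code) \<psi>" "\<psi> 0 0 0 = 0"
    using tiling_of_run by blast
  have "\<psi> x y m \<in> colours" for x y m
  proof -
    have "\<exists>\<beta> j. num_edge base_code \<beta> (\<psi> x y m) j"
      using \<psi>(1) unfolding tiling_def by (cases m rule: nonneg_or_neg_int) blast+
    then have "\<exists>\<beta> j. (\<psi> x y m, up_gen \<beta>, j) \<in> edges_of (num_edge base_code)" by simp
    then show ?thesis using instance_valid(2) by blast
  qed
  then show "seeded_tileable lamplighter lamp_gens colours (edges_of (num_edge base_code)) 0"
    unfolding seeded_tileable_edges_of using \<psi> by blast
qed

end

section \<open>Computability of the instance and the contradiction\<close>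

lemma computable_instance_number: "computable 1 (\<lambda>xs. instance_number (xs ! 0))"
proof -
  \<comment> \<open>Multiples become sums to fit the closure rules.\<close>
  have double: "2 * k = k + k" and triple: "3 * k = k + k + k" for k :: nat by simp_all
  have link: "computable (Suc (Suc 1)) (\<lambda>zs. link_weight (zs ! 0))"
    unfolding link_weight_def ec_def double
    by (intro computable_intros) simp_all
  have "computable 1 (\<lambda>xs. \<Sum>k<xs ! 0. link_weight k)"
    by (rule computable_sum[OF computable_nth link]) (simp_all only: nth_Cons_0 less_one)
  moreover have "computable 1 (\<lambda>xs. end_weight (xs ! 0))"
    unfolding end_weight_def ec_def double by (intro computable_intros) simp_all
  ultimately show ?thesis
    unfolding instance_number_def triple by (intro computable_intros) simp_all
qed

text \<open>Feeding the program its own tile set: the input \<open>2 ^ (p + 2)\<close> determines the code \<open>p\<close>.\<close>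

lemma ex_diagonal_recf:
  "\<exists>g. \<forall>p v. recf_eval f [instance_number p] v \<longrightarrow> recf_eval g [2 ^ (p + 2)] v"
proof -
  obtain fi where fi: "\<And>p. recf_eval fi [p] (instance_number p)"
    using computable_instance_number unfolding computable_def
    by (metis One_nat_def length_Cons list.size(3) nth_Cons_0)
  \<comment> \<open>On input \<open>2 ^ (p + 2)\<close> the truncated difference vanishes first at
    \<open>p\<close>, so minimisation recovers \<open>p\<close>.\<close>
  have "computable 2 (\<lambda>xs. xs ! 1 - 2 ^ (xs ! 0 + 2))"
    by (intro computable_intros) simp_all
  then obtain fm where fm: "\<And>xs. length xs = 2 \<Longrightarrow> recf_eval fm xs (xs ! 1 - 2 ^ (xs ! 0 + 2))"
    unfolding computable_def by blast
  have log: "recf_eval (Mu fm) [2 ^ (p + 2)] p" for p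
  proof (rule recf_eval.Mu)
    show "recf_eval fm [p, 2 ^ (p + 2)] 0" using fm[of "[p, 2 ^ (p + 2)]"] by simp
    show "\<forall>k<p. \<exists>z. recf_eval fm [k, 2 ^ (p + 2)] (Suc z)"
    proof (intro allI impI)
      fix k
      assume "k < p"
      then have "(2::nat) ^ (k + 2) < 2 ^ (p + 2)" by (intro power_strict_increasing) simp_all
      then obtain z where "(2::nat) ^ (p + 2) - 2 ^ (k + 2) = Suc z"
        by (metis Suc_pred zero_less_diff)
      then show "\<exists>z. recf_eval fm [k, 2 ^ (p + 2)] (Suc z)"
        using fm[of "[k, 2 ^ (p + 2)]"] by (intro exI[of _ z]) simp
    qed
  qed
  have "recf_eval (Comp f [Comp fi [Mu fm]]) [2 ^ (p + 2)] v" if "recf_eval f [instance_number p] v" for p v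
    by (rule recf_eval.Comp[where ys = "[instance_number p]"],
        use recf_eval.Comp[where ys = "[p]"] log fi that in fastforce, rule that)
  then show ?thesis by blast
qed

theorem theoremA:
  "\<not> (\<exists>f. \<forall>(A :: nat set) (P :: (nat \<times> lamp \<times> nat) set) (a0 :: nat).
      finite A \<and> P \<subseteq> A \<times> lamp_gens \<times> A \<and> a0 \<in> A \<longrightarrow>
      recf_eval f [instance_code A P a0]
        (if seeded_tileable lamplighter lamp_gens A P a0 then 1 else 0))"
proof (rule notI, elim exE)
  fix f
  assume f: "\<forall>(A :: nat set) (P :: (nat \<times> lamp \<times> nat) set) (a0 :: nat).
      finite A \<and> P \<subseteq> A \<times> lamp_gens \<times> A \<and> a0 \<in> A \<longrightarrow>
      recf_eval f [instance_code A P a0]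
        (if seeded_tileable lamplighter lamp_gens A P a0 then 1 else 0)"
  \<comment> \<open>\<open>g\<close> reads the code from its input, so the program is fixed before
    its own \<open>base_code\<close> is formed; the chain then supplies that code.\<close>
  obtain g where g: "\<And>p v. recf_eval f [instance_number p] v \<Longrightarrow> recf_eval g [2 ^ (p + 2)] v"
    using ex_diagonal_recf by blast
  obtain K where K: "K > 0" "regs_below K (decider g)"
    using ex_regs_below by blast
  obtain \<nu> where \<nu>: "inj_on \<nu> (cols (decider g) K)" "\<nu> (seed (decider g) K) = (0::nat)"
    "\<nu> (spine_mid (decider g)) = 1" "\<nu> (spine_end (decider g)) = 2" "\<nu> off_spine = 4"
    "\<nu> (spine_right (decider g)) = 6" "\<forall>u. odd (\<nu> u) \<longrightarrow> u = spine_mid (decider g)"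
    using ex_numbering by blast
  interpret numbered_program "decider g" K \<nu>
    by unfold_locales (use K \<nu> in \<open>auto simp: decider_def\<close>)
  let ?tileable = "seeded_tileable lamplighter lamp_gens colours (edges_of (num_edge base_code)) 0"
  have "recf_eval f [instance_number base_code] (if ?tileable then 1 else 0)"
    unfolding instance_code_eq[symmetric]
    by (rule f[rule_format]) (intro conjI instance_valid)
  \<comment> \<open>The program halts iff the answer is positive, that is, iff the instance is
    tileable; but tileability means that it does not halt.\<close>
  from decider_halts[OF g[OF this]]
  have "(\<exists>t. fst (run (decider g) (2 ^ (base_code + 2)) t) = Skip) \<longleftrightarrow> ?tileable"
    unfolding run_def by simp
  then show False using colours_tileable_iff by blast
qed

end
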